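(* Let $\alpha: G\curvearrowright X$ be a continuous action of a countably infinite discrete group $G$ on an infinite compact metrizable space $X$. Then the following are equivalent. (i) The generalized type semigroup $W(X,G)$ is almost unperforated. (ii) For any two finite sequences $(A_1,\dots,A_k)$ and $(B_1,\dots,B_l)$ of open sets in $X$ (with $k,l\geq 1$), if $\bigcup_{i=1}^k A_i\subset G\cdot\bigl(\bigcup_{j=1}^l B_j\bigr)$ and $\sum_{i=1}^k\mu(A_i)<\sum_{j=1}^l\mu(B_j)$ for every $\mu\in\operatorname{Pr}_G(X)$ with $\sum_{j=1}^l\mu(B_j)=1$, then \[\bigsqcup_{i=1}^k A_i\times\{i\}\prec\bigsqcup_{j=1}^l B_j\times\{j\}.\]
   Context: Relation $\prec$: for finite sequences of open sets $O_1,\dots,O_n$ and $V_1,\dots,V_m$ in $X$, write $\bigsqcup_{i=1}^n O_i\times\{i\}\prec\bigsqcup_{l=1}^m V_l\times\{l\}$ if for every choice of closed sets $F_i\subset O_i$ ($i=1,\dots,n$) there are, for each $i$, a finite collection of open sets $U^{(i)}_1,\dots,U^{(i)}_{J_i}$ covering $F_i$, elements $s^{(i)}_1,\dots,s^{(i)}_{J_i}\in G$ and indices $k^{(i)}_1,\dots,k^{(i)}_{J_i}\in\{1,\dots,m\}$ such that the sets $s^{(i)}_jU^{(i)}_j\times\{k^{(i)}_j\}$ ($1\le i\le n$, $1\le j\le J_i$) are pairwise disjoint and all contained in $\bigsqcup_{l=1}^m V_l\times\{l\}$. Generalized type semigroup: $C(X)_+$ is the set of non-negative continuous functions on $X$;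 for $f\in C(X)_+$, $\operatorname{supp}(f)=\{x\in X: f(x)\neq 0\}$ (open support). Let $K(X,G)=\bigcup_{n=1}^\infty C(X)_+^{\oplus n}$ (finite tuples). For $a=(f_1,\dots,f_n)$ and $b=(g_1,\dots,g_m)$ in $K(X,G)$ write $a\preccurlyeq b$ if $\bigsqcup_{i=1}^n\operatorname{supp}(f_i)\times\{i\}\prec\bigsqcup_{l=1}^m\operatorname{supp}(g_l)\times\{l\}$. The relation $\preccurlyeq$ is reflexive and transitive; write $a\approx b$ if $a\preccurlyeq b$ and $b\preccurlyeq a$. $W(X,G)=K(X,G)/\approx$, with addition $[a]+[b]=[(a,b)]$ (concatenation of tuples) and partial order $[a]\le[b]$ iff $a\preccurlyeq b$; this is an abelian partially ordered semigroup. Almost unperforated: for $x,y\in W(X,G)$, if $(n+1)x\le ny$ for some positive integer $n$, then $x\le y$. Premeasures: $\mathcal{A}_0$ is the algebra of subsets of $X$ generated by the open sets. A premeasure on $\mathcal{A}_0$ is a function $\mu:\mathcal{A}_0\to[0,\infty]$ with $\mu(\emptyset)=0$ and $\mu(\bigsqcup_{n=1}^\infty A_n)=\sum_{n=1}^\infty\mu(A_n)$ for each disjoint sequence $(A_n)$ in $\mathcal{A}_0$ whose union is in $\mathcal{A}_0$. $\operatorname{Pr}_G(X)$ is the set of all $G$-invariant premeasures $\mu$ on $\mathcal{A}_0$ that are regular: for all $B\in\mathcal{A}_0$, $\mu(B)=\sup\{\mu(F):F\subset B,\ F\text{ compact}\}$ and $\mu(B)=\inf\{\mu(O):B\subset O,\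 O\text{ open}\}$. $G\cdot B=\bigcup_{g\in G}gB$. *)

theory Defs
  imports "HOL-Analysis.Analysis" "HOL-Algebra.Group_Action"
begin

text \<open>
  Throughout, \<open>G\<close> is a (discrete) group acting on the space \<open>UNIV :: 'x set\<close> by \<open>\<phi>\<close>; the translate
  \<open>g U\<close> is written \<open>\<phi> g ` U\<close>.  Finite sequences are lists, so their indices start at 0.
\<close>

text \<open>Continuity is joint continuity of \<open>G \<times> X \<rightarrow> X\<close>, with \<open>G\<close> carrying the discrete topology.\<close>

definition continuous_action ::
    "('g, 'm) monoid_scheme \<Rightarrow> ('g \<Rightarrow> 'x \<Rightarrow> 'x::topological_space) \<Rightarrow> bool" where
  "continuous_action G \<phi> \<longleftrightarrow>
     group_action G UNIV \<phi> \<and>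
     continuous_map (prod_topology (discrete_topology (carrier G)) euclidean) euclidean
       (\<lambda>(g, x). \<phi> g x)"

definition tagged_union :: "'x set list \<Rightarrow> ('x \<times> nat) set" where
  "tagged_union Vs = (\<Union>l<length Vs. (Vs ! l) \<times> {l})"

definition dyn_subequiv ::
    "('g, 'm) monoid_scheme \<Rightarrow> ('g \<Rightarrow> 'x \<Rightarrow> 'x::topological_space) \<Rightarrow>
     'x set list \<Rightarrow> 'x set list \<Rightarrow> bool" where
  "dyn_subequiv G \<phi> Os Vs \<longleftrightarrow>
     (\<forall>F :: nat \<Rightarrow> 'x set. (\<forall>i<length Os. closed (F i) \<and> F i \<subseteq> Os ! i) \<longrightarrow>
       (\<exists>(J :: nat \<Rightarrow> nat) (U :: nat \<Rightarrow> nat \<Rightarrow> 'x set) (s :: nat \<Rightarrow> nat \<Rightarrow> 'g)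
          (k :: nat \<Rightarrow> nat \<Rightarrow> nat).
          (\<forall>i<length Os.
             F i \<subseteq> (\<Union>j<J i. U i j) \<and>
             (\<forall>j<J i. open (U i j) \<and> s i j \<in> carrier G \<and> k i j < length Vs \<and>
                (\<phi> (s i j) ` U i j) \<times> {k i j} \<subseteq> tagged_union Vs)) \<and>
          disjoint_family_on (\<lambda>(i, j). (\<phi> (s i j) ` U i j) \<times> {k i j})
            (SIGMA i:{..<length Os}. {..<J i})))"

subsection \<open>The generalized type semigroup\<close>

definition nonneg_continuous :: "('x::topological_space \<Rightarrow> real) set" where
  "nonneg_continuous = {f. continuous_on UNIV f \<and> (\<forall>x. 0 \<le> f x)}"

definition K_tuples :: "('x::topological_space \<Rightarrow> real) list set" where
  "K_tuples = {fs. fs \<noteq> [] \<and> set fs \<subseteq> nonneg_continuous}"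

text \<open>\<^const>\<open>support_on\<close> is the open support (no closure is taken).\<close>

definition K_le ::
    "('g, 'm) monoid_scheme \<Rightarrow> ('g \<Rightarrow> 'x \<Rightarrow> 'x::topological_space) \<Rightarrow>
     ('x \<Rightarrow> real) list \<Rightarrow> ('x \<Rightarrow> real) list \<Rightarrow> bool" where
  "K_le G \<phi> a b \<longleftrightarrow> dyn_subequiv G \<phi> (map (support_on UNIV) a) (map (support_on UNIV) b)"

definition K_equiv ::
    "('g, 'm) monoid_scheme \<Rightarrow> ('g \<Rightarrow> 'x \<Rightarrow> 'x::topological_space) \<Rightarrow>
     (('x \<Rightarrow> real) list \<times> ('x \<Rightarrow> real) list) set" where
  "K_equiv G \<phi> = {(a, b). a \<in> K_tuples \<and> b \<in> K_tuples \<and> K_le G \<phi> a b \<and> K_le G \<phi> b a}"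

definition W_carrier ::
    "('g, 'm) monoid_scheme \<Rightarrow> ('g \<Rightarrow> 'x \<Rightarrow> 'x::topological_space) \<Rightarrow>
     ('x \<Rightarrow> real) list set set" where
  "W_carrier G \<phi> = K_tuples // K_equiv G \<phi>"

text \<open>
  Addition and order are given on representatives.  As \<^const>\<open>K_equiv\<close> respects concatenation,
  the union in \<open>W_add\<close> is over equal classes.
\<close>

definition W_add ::
    "('g, 'm) monoid_scheme \<Rightarrow> ('g \<Rightarrow> 'x \<Rightarrow> 'x::topological_space) \<Rightarrow>
     ('x \<Rightarrow> real) list set \<Rightarrow> ('x \<Rightarrow> real) list set \<Rightarrow> ('x \<Rightarrow> real) list set" where
  "W_add G \<phi> x y = (\<Union>a\<in>x. \<Union>b\<in>y. K_equiv G \<phi> `` {a @ b})"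

definition W_le ::
    "('g, 'm) monoid_scheme \<Rightarrow> ('g \<Rightarrow> 'x \<Rightarrow> 'x::topological_space) \<Rightarrow>
     ('x \<Rightarrow> real) list set \<Rightarrow> ('x \<Rightarrow> real) list set \<Rightarrow> bool" where
  "W_le G \<phi> x y \<longleftrightarrow> (\<exists>a\<in>x. \<exists>b\<in>y. K_le G \<phi> a b)"

text \<open>The multiple \<open>n x = x + \<dots> + x\<close> in a semigroup, meaningful for \<open>n \<ge> 1\<close>.\<close>

definition sg_multiple :: "('a \<Rightarrow> 'a \<Rightarrow> 'a) \<Rightarrow> nat \<Rightarrow> 'a \<Rightarrow> 'a" where
  "sg_multiple add n x = (add x ^^ (n - 1)) x"

definition almost_unperforated ::
    "'a set \<Rightarrow> ('a \<Rightarrow> 'a \<Rightarrow> 'a) \<Rightarrow> ('a \<Rightarrow> 'a \<Rightarrow> bool) \<Rightarrow> bool" where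
  "almost_unperforated S add leq \<longleftrightarrow>
     (\<forall>x\<in>S. \<forall>y\<in>S. (\<exists>n>0. leq (sg_multiple add (n + 1) x) (sg_multiple add n y)) \<longrightarrow> leq x y)"

subsection \<open>Regular invariant premeasures\<close>

definition open_algebra :: "'x::topological_space set set" where
  "open_algebra = Sigma_Algebra.algebra UNIV hull {U. open U}"

text \<open>
  A premeasure is represented by a function on all sets of which only the values on
  \<^const>\<open>open_algebra\<close> matter.
\<close>

definition invariant_premeasures ::
    "('g, 'm) monoid_scheme \<Rightarrow> ('g \<Rightarrow> 'x \<Rightarrow> 'x::topological_space) \<Rightarrow>
     ('x set \<Rightarrow> ennreal) set" where
  "invariant_premeasures G \<phi> =
     {\<mu>. positive open_algebra \<mu> \<and> countably_additive open_algebra \<mu> \<and>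
         (\<forall>g\<in>carrier G. \<forall>B\<in>open_algebra. \<mu> (\<phi> g ` B) = \<mu> B) \<and>
         (\<forall>B\<in>open_algebra.
            \<mu> B = (SUP F\<in>{F. F \<subseteq> B \<and> compact F}. \<mu> F) \<and>
            \<mu> B = (INF V\<in>{V. B \<subseteq> V \<and> open V}. \<mu> V))}"

definition saturation ::
    "('g, 'm) monoid_scheme \<Rightarrow> ('g \<Rightarrow> 'x \<Rightarrow> 'x) \<Rightarrow> 'x set \<Rightarrow> 'x set" where
  "saturation G \<phi> B = (\<Union>g\<in>carrier G. \<phi> g ` B)"

end

theory Submission
  imports Defs "HOL-Library.Poly_Mapping"
begin

text \<open>
  Write \<open>A \<prec> B\<close> for dynamical subequivalence of lists of open sets and \<open>n A\<close> for \<open>n\<close> concatenated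
  copies of \<open>A\<close>.  As every open set of a metric space is the open support of a non-negative
  continuous function, almost unperforation says that \<open>(n + 1) A \<prec> n B\<close> with \<open>n \<ge> 1\<close> implies
  \<open>A \<prec> B\<close> (\<open>almost_unperforated_iff\<close>).

  An invariant premeasure is monotone under \<open>\<prec>\<close>, because open sets are increasing unions of closed sets
  (\<open>premeasure_le_of_dyn_subequiv\<close>).  So if \<open>(n + 1) A \<prec> n B\<close> and \<open>\<mu>(B) = 1\<close>, then
  \<open>\<mu>(A) \<le> n / (n + 1) < 1\<close>; moreover every point of \<open>A\<close> can be moved into \<open>B\<close>.  Strict comparison then
  yields \<open>A \<prec> B\<close>, which is one half of the equivalence.

  For the other half, let \<open>A\<close> and \<open>B\<close> satisfy the measure condition.  Since \<open>\<prec>\<close> tests only closed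
  subsets, it suffices to show \<open>A' \<prec> B\<close> for every list \<open>A'\<close> of open sets whose closures lie in
  the sets of \<open>A\<close> (\<open>dyn_subequiv_approx\<close>), hence by almost unperforation
  that \<open>(m + 1) A' \<prec> m B\<close> for some \<open>m \<ge> 1\<close>.  By compactness \<open>A'\<close> is bounded by a multiple of \<open>B\<close>.  If no
  such \<open>m\<close> existed, a separation argument of Hahn-Banach type (\<open>exists_normalized_state\<close>) would give
  an additive \<open>\<prec>\<close>-monotone \<open>D\<close> on lists of open sets with \<open>D(B) = 1 \<le> D(A')\<close>.  This \<open>D\<close> need not be a measure, but its
  regularization \<open>\<mu>(V) = sup {D(W) | closure W \<subseteq> V}\<close> extends to a regular invariant premeasure,
  with \<open>D(A') \<le> \<mu>(A)\<close> and \<open>\<mu>(B) \<le> D(B)\<close>.  So \<open>\<mu>(B) \<le> 1 \<le> \<mu>(A)\<close>.  If \<open>\<mu>(B) > 0\<close>, rescaling \<open>\<mu>\<close> contradicts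
  the measure condition.  If \<open>\<mu>(B) = 0\<close>, then \<open>\<mu>(A) = 0\<close> because countably many translates of \<open>B\<close>
  cover \<open>A\<close>, a contradiction as well.  Passing from \<open>A\<close> to \<open>A'\<close> is what absorbs the loss in the
  regularization.
\<close>

section \<open>States on preordered multisets\<close>

text \<open>
  The order-theoretic core of the Hahn-Banach argument.  A cone that is maximal among those
  avoiding all \<open>- n u\<close> orders the group totally: if neither \<open>z\<close> nor \<open>- z\<close> could be adjoined, then
  \<open>- n u = c + k z\<close> and \<open>- n' u = c' - k' z\<close>, and eliminating \<open>z\<close> puts a negative multiple of \<open>u\<close>
  into the cone.
\<close>

lemma maximal_frag_cone_total:
  fixes C :: "('a \<Rightarrow>\<^sub>0 int) set"
  assumes zero: "0 \<in> C" and add: "\<And>v w. v \<in> C \<Longrightarrow> w \<in> C \<Longrightarrow> v + w \<in> C"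
    and avoid: "\<And>n. n > 0 \<Longrightarrow> frag_cmul (- int n) u \<notin> C"
  obtains M where "C \<subseteq> M" "\<And>v w. v \<in> M \<Longrightarrow> w \<in> M \<Longrightarrow> v + w \<in> M"
    "\<And>n. n > 0 \<Longrightarrow> frag_cmul (- int n) u \<notin> M" "\<And>z. z \<in> M \<or> - z \<in> M"
proof -
  define \<A> where "\<A> = {M. C \<subseteq> M \<and> (\<forall>v\<in>M. \<forall>w\<in>M. v + w \<in> M) \<and>
      (\<forall>n>0. frag_cmul (- int n) u \<notin> M)}"
  have "C \<in> \<A>" using add avoid by (auto simp: \<A>_def)
  have "\<exists>M\<in>\<A>. \<forall>X\<in>\<A>. M \<subseteq> X \<longrightarrow> X = M"
  proof (rule subset_Zorn_nonempty)
    fix \<C> assume ne: "\<C> \<noteq> {}" and ch: "subset.chain \<A> \<C>"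
    have sub: "\<C> \<subseteq> \<A>" using ch by (simp add: subset_chain_def)
    show "\<Union>\<C> \<in> \<A>"
      unfolding \<A>_def mem_Collect_eq
    proof (intro conjI ballI allI impI)
      show "C \<subseteq> \<Union>\<C>"
      proof -
        obtain Y where "Y \<in> \<C>" using ne by blast
        then have "C \<subseteq> Y" using sub by (auto simp: \<A>_def)
        then show ?thesis using \<open>Y \<in> \<C>\<close> by blast
      qed
      show "v + w \<in> \<Union>\<C>" if "v \<in> \<Union>\<C>" "w \<in> \<Union>\<C>" for v w
      proof -
        obtain V W where VW: "v \<in> V" "V \<in> \<C>" "w \<in> W" "W \<in> \<C>" using \<open>v \<in> \<Union>\<C>\<close> \<open>w \<in> \<Union>\<C>\<close> by blast
        then have "V \<subseteq> W \<or> W \<subseteq> V" using ch by (auto simp: subset_chain_def)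
        then obtain Z where "Z \<in> \<C>" "v \<in> Z" "w \<in> Z" using VW by blast
        then have "v + w \<in> Z" using sub by (auto simp: \<A>_def)
        then show ?thesis using \<open>Z \<in> \<C>\<close> by blast
      qed
      show "frag_cmul (- int n) u \<notin> \<Union>\<C>" if "n > 0" for n using sub that by (auto simp: \<A>_def)
    qed
  qed (use \<open>C \<in> \<A>\<close> in blast)
  then obtain M where M: "M \<in> \<A>" and max: "\<And>X. X \<in> \<A> \<Longrightarrow> M \<subseteq> X \<Longrightarrow> X = M" by blast
  have CM: "C \<subseteq> M" and addM: "\<And>v w. v \<in> M \<Longrightarrow> w \<in> M \<Longrightarrow> v + w \<in> M"
    and avM: "\<And>n. n > 0 \<Longrightarrow> frag_cmul (- int n) u \<notin> M" using M by (auto simp: \<A>_def)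
  have mult: "frag_cmul (int k) c \<in> M" if "c \<in> M" for c k
  proof (induction k)
    case 0 then show ?case using zero CM by auto
  next
    case (Suc k)
    have "frag_cmul (int (Suc k)) c = c + frag_cmul (int k) c" by (simp add: frag_cmul_distrib)
    with Suc show ?case using addM that by metis
  qed
  have ext: "\<exists>k n c. n > 0 \<and> c \<in> M \<and> frag_cmul (- int n) u = c + frag_cmul (int k) z" if "z \<notin> M" for z
  proof (rule ccontr)
    assume neg: "\<not> ?thesis"
    define X where "X = {c + frag_cmul (int k) z | c k. c \<in> M}"
    have MX: "M \<subseteq> X"
    proof
      fix c assume "c \<in> M"
      then show "c \<in> X" unfolding X_def by (intro CollectI exI[of _ c] exI[of _ 0]) auto
    qed
    have "X \<in> \<A>"
      unfolding \<A>_def mem_Collect_eq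
    proof (intro conjI ballI allI impI)
      show "C \<subseteq> X" using MX CM by blast
      show "v + w \<in> X" if "v \<in> X" "w \<in> X" for v w
      proof -
        obtain c k c' k' where "v = c + frag_cmul (int k) z" "c \<in> M" "w = c' + frag_cmul (int k') z" "c' \<in> M"
          using \<open>v \<in> X\<close> \<open>w \<in> X\<close> unfolding X_def by blast
        moreover from this have "v + w = (c + c') + frag_cmul (int (k + k')) z"
          by (simp add: frag_cmul_distrib algebra_simps)
        ultimately show ?thesis using addM unfolding X_def by blast
      qed
      show "frag_cmul (- int n) u \<notin> X" if "n > 0" for n using neg that unfolding X_def by blast
    qed
    then have "X = M" using max MX by blast
    moreover have "z \<in> X"
      unfolding X_def using zero CM by (intro CollectI exI[of _ 0] exI[of _ 1]) auto
    ultimately show False using that by blast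
  qed
  have tot: "z \<in> M \<or> - z \<in> M" for z
  proof (rule ccontr)
    assume "\<not> ?thesis"
    then obtain k n c k' n' c' where
      1: "n > 0" "c \<in> M" "frag_cmul (- int n) u = c + frag_cmul (int k) z" and
      2: "n' > 0" "c' \<in> M" "frag_cmul (- int n') u = c' + frag_cmul (int k') (- z)"
      using ext by meson
    have k: "k > 0" using 1 avM by (metis add.right_neutral frag_cmul_zero gr0I of_nat_0)
    have "frag_cmul (- int (k' * n + k * n')) u
        = frag_cmul (int k') (frag_cmul (- int n) u) + frag_cmul (int k) (frag_cmul (- int n') u)"
      by (simp add: frag_cmul_distrib[symmetric] algebra_simps)
    also have "\<dots> = frag_cmul (int k') c + frag_cmul (int k) c'"
      unfolding 1(3) 2(3) by (simp add: frag_cmul_distrib2 poly_mapping_eqI lookup_add mult.commute)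
    also have "\<dots> \<in> M" using mult 1 2 addM by blast
    finally show False using avM[of "k' * n + k * n'"] k 2(1) by simp
  qed
  show ?thesis using that[of M] CM addM avM tot by blast
qed

text \<open>
  In the total order given by a maximal cone \<open>M\<close>, the functional measures \<open>z\<close> against \<open>u\<close>: \<open>f z\<close> is the
  cut defined by the rationals \<open>m / n\<close> with \<open>n z \<ge> m u\<close>.  Totality makes this cut both a supremum
  of lower and an infimum of upper fractions; the first gives superadditivity and the second
  subadditivity.
\<close>

lemma frag_positive_functional:
  fixes C :: "('a \<Rightarrow>\<^sub>0 int) set"
  assumes zero: "0 \<in> C" and add: "\<And>v w. v \<in> C \<Longrightarrow> w \<in> C \<Longrightarrow> v + w \<in> C"
    and unit: "\<And>z. \<exists>n::nat. frag_cmul (int n) u - z \<in> C"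
    and avoid: "\<And>n. n > 0 \<Longrightarrow> frag_cmul (- int n) u \<notin> C"
  obtains f :: "('a \<Rightarrow>\<^sub>0 int) \<Rightarrow> real"
  where "\<And>v w. f (v + w) = f v + f w" "f u = 1" "\<And>v. v \<in> C \<Longrightarrow> f v \<ge> 0"
proof -
  obtain M where CM: "C \<subseteq> M" and addM: "\<And>v w. v \<in> M \<Longrightarrow> w \<in> M \<Longrightarrow> v + w \<in> M"
    and avM: "\<And>n. n > 0 \<Longrightarrow> frag_cmul (- int n) u \<notin> M" and tot: "\<And>z. z \<in> M \<or> - z \<in> M"
    using maximal_frag_cone_total[OF zero add avoid] by blast
  have mult: "frag_cmul (int k) c \<in> M" if "c \<in> M" for c k
  proof (induction k)
    case 0 then show ?case using zero CM by auto
  next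
    case (Suc k)
    have "frag_cmul (int (Suc k)) c = c + frag_cmul (int k) c" by (simp add: frag_cmul_distrib)
    with Suc show ?case using addM that by metis
  qed
  have uM: "u \<in> M" using tot[of u] avM[of 1] by auto
  define L where "L z = {q. \<exists>n m. n > 0 \<and> q = real_of_int m / real n \<and> frag_cmul (int n) z - frag_cmul m u \<in> M}" for z
  define f where "f z = Sup (L z)" for z
  define U where "U z = {q. - q \<in> L (- z)}" for z
  have Ladd: "p + q \<in> L (v + w)" if p: "p \<in> L v" and q: "q \<in> L w" for p q v w
  proof -
    obtain n m where 1: "n > 0" "p = real_of_int m / real n" "frag_cmul (int n) v - frag_cmul m u \<in> M"
      using p unfolding L_def by blast
    obtain n' m' where 2: "n' > 0" "q = real_of_int m' / real n'" "frag_cmul (int n') w - frag_cmul m' u \<in> M"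
      using q unfolding L_def by blast
    have "frag_cmul (int (n * n')) (v + w) - frag_cmul (m * int n' + m' * int n) u
       = frag_cmul (int n') (frag_cmul (int n) v - frag_cmul m u) + frag_cmul (int n) (frag_cmul (int n') w - frag_cmul m' u)"
      by (rule poly_mapping_eqI) (simp add: lookup_add lookup_minus algebra_simps)
    also have "\<dots> \<in> M" using mult addM 1 2 by blast
    finally show ?thesis unfolding L_def
      using 1 2 by (intro CollectI exI[of _ "n * n'"] exI[of _ "m * int n' + m' * int n"])
        (auto simp: field_simps)
  qed
  have Lzero: "p \<le> 0" if p: "p \<in> L 0" for p
  proof -
    obtain n m where 1: "n > 0" "p = real_of_int m / real n" "frag_cmul (- m) u \<in> M"
      using p unfolding L_def by auto
    then have "\<not> m > 0" using avM[of "nat m"] by auto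
    then show ?thesis using 1 by (simp add: divide_nonpos_pos)
  qed
  have LU: "p \<le> q" if "p \<in> L z" "q \<in> U z" for p q z
    using Ladd[of p z "- q" "- z"] Lzero that by (force simp: U_def)
  have rat: "q \<in> L z \<or> q \<in> U z" if "q \<in> \<rat>" for q z
  proof -
    obtain m n where n: "n > 0" "q = real_of_int m / real_of_int n" using Rats_cases'[OF \<open>q \<in> \<rat>\<close>] by metis
    define k where "k = nat n"
    have k: "k > 0" "q = real_of_int m / real k" using n by (auto simp: k_def)
    have "frag_cmul (int k) z - frag_cmul m u \<in> M \<or> - (frag_cmul (int k) z - frag_cmul m u) \<in> M"
      using tot by blast
    moreover have "- (frag_cmul (int k) z - frag_cmul m u) = frag_cmul (int k) (- z) - frag_cmul (- m) u"
      by (rule poly_mapping_eqI) (simp add: lookup_minus)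
    ultimately consider "frag_cmul (int k) z - frag_cmul m u \<in> M"
      | "frag_cmul (int k) (- z) - frag_cmul (- m) u \<in> M" by metis
    then show ?thesis
    proof cases
      case 1 then show ?thesis using k unfolding L_def by blast
    next
      case 2
      have "- q = real_of_int (- m) / real k" using k by simp
      then have "- q \<in> L (- z)" using 2 k(1) unfolding L_def by blast
      then show ?thesis by (simp add: U_def)
    qed
  qed
  have Lne: "\<exists>p. p \<in> L z" for z
  proof -
    obtain n where "frag_cmul (int n) u - (- z) \<in> M" using unit[of "- z"] CM by blast
    moreover have "frag_cmul (int n) u - (- z) = frag_cmul (int 1) z - frag_cmul (- int n) u"
      by (rule poly_mapping_eqI) (simp add: lookup_add lookup_minus)
    ultimately have "frag_cmul (int 1) z - frag_cmul (- int n) u \<in> M" by metis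
    then have "real_of_int (- int n) / real 1 \<in> L z"
      unfolding L_def by (intro CollectI exI[of _ 1] exI[of _ "- int n"] conjI; (assumption | simp))
    then show ?thesis by blast
  qed
  have Une: "\<exists>p. p \<in> U z" for z using Lne[of "- z"] unfolding U_def by (metis mem_Collect_eq minus_minus)
  have bdd: "bdd_above (L z)" for z using Une[of z] LU unfolding bdd_above_def by blast
  have Lf: "p \<le> f z" if "p \<in> L z" for p z unfolding f_def using bdd that by (rule cSup_upper[rotated])
  have fU: "f z \<le> p" if "p \<in> U z" for p z
    unfolding f_def by (rule cSup_least) (use Lne LU that in blast)+
  have below: "r \<in> L z" if "r \<in> \<rat>" "r < f z" for r z using rat[OF that(1)] fU[of r z] that by auto
  have above: "r \<in> U z" if "r \<in> \<rat>" "f z < r" for r z using rat[OF that(1)] Lf[of r z] that by auto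
  have add1: "f v + f w \<le> f (v + w)" for v w
  proof (rule ccontr)
    assume "\<not> ?thesis"
    then have "f (v + w) - f w < f v" by simp
    then obtain r where r: "r \<in> \<rat>" "f (v + w) - f w < r" "r < f v" using Rats_dense_in_real by blast
    then have "f (v + w) - r < f w" by simp
    then obtain s where s: "s \<in> \<rat>" "f (v + w) - r < s" "s < f w" using Rats_dense_in_real by blast
    have "r + s \<le> f (v + w)" using Ladd Lf below r s by blast
    then show False using s by simp
  qed
  have add2: "f (v + w) \<le> f v + f w" for v w
  proof (rule ccontr)
    assume "\<not> ?thesis"
    then have "f v < f (v + w) - f w" by simp
    then obtain r where r: "r \<in> \<rat>" "r < f (v + w) - f w" "f v < r" using Rats_dense_in_real by blast
    then have "f w < f (v + w) - r" by simp
    then obtain s where s: "s \<in> \<rat>" "s < f (v + w) - r" "f w < s" using Rats_dense_in_real by blast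
    have "- r \<in> L (- v)" "- s \<in> L (- w)" using above r s by (auto simp: U_def)
    then have "r + s \<in> U (v + w)" using Ladd[of "- r" "- v" "- s" "- w"] by (simp add: U_def)
    then have "f (v + w) \<le> r + s" by (rule fU)
    then show False using s by simp
  qed
  have "real_of_int 1 / real 1 \<in> L u" unfolding L_def using zero CM
    by (intro CollectI exI[of _ 1]) auto
  moreover have "real_of_int (- 1) / real 1 \<in> L (- u)" unfolding L_def using zero CM
    by (intro CollectI exI[of _ 1] exI[of _ "-1"]) auto
  ultimately have "f u = 1" using Lf[of 1 u] fU[of 1 u] by (auto simp: U_def)
  moreover have "f v \<ge> 0" if "v \<in> C" for v
  proof -
    have "real_of_int 0 / real 1 \<in> L v" unfolding L_def using that CM
      by (intro CollectI exI[of _ 1] exI[of _ 0]) auto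
    then show ?thesis using Lf by fastforce
  qed
  ultimately show ?thesis using that[of f] add1 add2 by (meson order_antisym)
qed

definition frag_of_mset :: "'a multiset \<Rightarrow> ('a \<Rightarrow>\<^sub>0 int)" where
  "frag_of_mset M = (\<Sum>a\<in>#M. frag_of a)"

lemma frag_of_mset_simps [simp]:
  "frag_of_mset {#} = 0" "frag_of_mset (add_mset a M) = frag_of a + frag_of_mset M"
  "frag_of_mset (M + N) = frag_of_mset M + frag_of_mset N"
  by (auto simp: frag_of_mset_def)

lemma frag_of_mset_repeat [simp]: "frag_of_mset (repeat_mset n M) = frag_cmul (int n) (frag_of_mset M)"
  by (induction n) (auto simp: frag_cmul_distrib algebra_simps)

lemma lookup_frag_of_mset [simp]: "Poly_Mapping.lookup (frag_of_mset M) a = int (count M a)"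
  by (induction M) (auto simp: lookup_add lookup_single when_def)

text \<open>
  A version without cancellation of the Goodearl-Handelman theorem on states: if \<open>y\<close> is an order
  unit and \<open>(m + 1) x \<preceq> m y\<close> never holds, some state normalized at \<open>y\<close> has value at least \<open>1\<close> at \<open>x\<close>.
  In the free abelian group, consider the cone generated by all differences \<open>N - M\<close> with
  \<open>M \<preceq> N\<close> together with \<open>x - y\<close>, the latter in order to force \<open>f x \<ge> f y\<close>.  It is enough that this
  cone avoids \<open>- n y\<close> for \<open>n > 0\<close>.
\<close>

lemma exists_normalized_state:
  fixes le :: "'a multiset \<Rightarrow> 'a multiset \<Rightarrow> bool" (infix \<open>\<preceq>\<close> 50)
  assumes refl: "\<And>M. M \<preceq> M" and trans: "\<And>M N P. M \<preceq> N \<Longrightarrow> N \<preceq> P \<Longrightarrow> M \<preceq> P"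
    and add: "\<And>M N P. M \<preceq> N \<Longrightarrow> M + P \<preceq> N + P" and pos: "\<And>M. {#} \<preceq> M"
    and unit: "\<And>a. \<exists>n. {#a#} \<preceq> repeat_mset n y"
    and noperf: "\<And>m. m > 0 \<Longrightarrow> \<not> repeat_mset (Suc m) x \<preceq> repeat_mset m y"
  obtains d :: "'a \<Rightarrow> real"
  where "\<And>a. 0 \<le> d a" "\<And>M N. M \<preceq> N \<Longrightarrow> (\<Sum>a\<in>#M. d a) \<le> (\<Sum>a\<in>#N. d a)"
    "(\<Sum>a\<in>#y. d a) = 1" "(\<Sum>a\<in>#x. d a) \<ge> 1"
proof -
  let ?e = frag_of_mset
  note [trans] = trans
  have add2: "M + M' \<preceq> N + N'" if "M \<preceq> N" "M' \<preceq> N'" for M N M' N'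
    using add[OF that(1), of M'] add[OF that(2), of N] trans by (simp add: add.commute)
  have rep: "repeat_mset n M \<preceq> repeat_mset n N" if "M \<preceq> N" for M N n
    by (induction n) (use that refl add2 in auto)
  have mono: "repeat_mset m M \<preceq> repeat_mset n M" if "m \<le> n" for m n M
  proof -
    have "repeat_mset m M + {#} \<preceq> repeat_mset m M + repeat_mset (n - m) M"
      by (rule add2[OF refl pos])
    then show ?thesis using that by (simp flip: repeat_mset_distrib)
  qed
  have bound: "\<exists>n. M \<preceq> repeat_mset n y" for M
  proof (induction M)
    case empty show ?case using pos by blast
  next
    case (add a M)
    then obtain n where n: "M \<preceq> repeat_mset n y" by blast
    obtain k where k: "{#a#} \<preceq> repeat_mset k y" using unit by blast
    have "{#a#} + M \<preceq> repeat_mset k y + repeat_mset n y" using add2[OF k n] .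
    then show ?case by (auto simp flip: repeat_mset_distrib)
  qed
  define C where "C = {?e N - ?e M + frag_cmul (int k) (?e x - ?e y) | M N k. M \<preceq> N}"
  have CI: "?e N - ?e M \<in> C" if "M \<preceq> N" for M N
    unfolding C_def using that by (intro CollectI exI[of _ M] exI[of _ N] exI[of _ 0]) auto
  obtain f :: "('a \<Rightarrow>\<^sub>0 int) \<Rightarrow> real" where
    f: "\<And>v w. f (v + w) = f v + f w" "f (?e y) = 1" "\<And>v. v \<in> C \<Longrightarrow> f v \<ge> 0"
  proof (rule frag_positive_functional)
    show "0 \<in> C" using CI[OF refl[of "{#}"]] by simp
    show "v + w \<in> C" if vw: "v \<in> C" "w \<in> C" for v w
    proof -
      obtain M N k where 1: "M \<preceq> N" "v = ?e N - ?e M + frag_cmul (int k) (?e x - ?e y)"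
        using vw unfolding C_def by blast
      obtain M' N' k' where 2: "M' \<preceq> N'" "w = ?e N' - ?e M' + frag_cmul (int k') (?e x - ?e y)"
        using vw unfolding C_def by blast
      have "v + w = ?e (N + N') - ?e (M + M') + frag_cmul (int (k + k')) (?e x - ?e y)"
        by (simp add: 1 2 frag_cmul_distrib)
      then show ?thesis unfolding C_def using add2 1 2 by blast
    qed
    note Cadd = this
    have Cy: "frag_cmul (int n) (?e y) \<in> C" for n using CI[OF pos[of "repeat_mset n y"]] by simp
    have "\<exists>n::nat. frag_cmul (int n) (?e y) - z \<in> C \<and> frag_cmul (int n) (?e y) + z \<in> C" for z
      using subset_UNIV[of "Poly_Mapping.keys z"]
    proof (induction z rule: frag_induction)
      case zero then show ?case using Cy by auto
    next
      case (one a)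
      obtain n where n: "{#a#} \<preceq> repeat_mset n y" using unit by blast
      show ?case using CI[OF n] CI[OF pos[of "{#a#} + repeat_mset n y"]] by (auto simp: add.commute)
    next
      case (diff a b)
      then obtain n m :: nat where
        n: "frag_cmul (int n) (?e y) - a \<in> C" "frag_cmul (int n) (?e y) + a \<in> C" and
        m: "frag_cmul (int m) (?e y) - b \<in> C" "frag_cmul (int m) (?e y) + b \<in> C" by blast
      have "frag_cmul (int (n + m)) (?e y) - (a - b) = (frag_cmul (int n) (?e y) - a) + (frag_cmul (int m) (?e y) + b)"
        "frag_cmul (int (n + m)) (?e y) + (a - b) = (frag_cmul (int n) (?e y) + a) + (frag_cmul (int m) (?e y) - b)"
        by (auto simp: frag_cmul_distrib)
      then show ?case using Cadd n m by metis
    qed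
    then show "\<exists>n::nat. frag_cmul (int n) (?e y) - z \<in> C" for z by blast
    show "frag_cmul (- int n) (?e y) \<notin> C" if n: "n > 0" for n
    proof
      assume "frag_cmul (- int n) (?e y) \<in> C"
      then obtain M N k where MN: "M \<preceq> N" and
        eq: "frag_cmul (- int n) (?e y) = ?e N - ?e M + frag_cmul (int k) (?e x - ?e y)" unfolding C_def by blast
      have eqm: "N + repeat_mset k x + repeat_mset n y = M + repeat_mset k y"
      proof (rule multiset_eqI)
        fix a
        from arg_cong[OF eq, of "\<lambda>z. Poly_Mapping.lookup z a"]
        have "int (count (N + repeat_mset k x + repeat_mset n y) a) = int (count (M + repeat_mset k y) a)"
          by (simp add: lookup_add lookup_minus algebra_simps)
        then show "count (N + repeat_mset k x + repeat_mset n y) a = count (M + repeat_mset k y) a"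
          by (simp only: of_nat_eq_iff)
      qed
      define w where "w = repeat_mset k x + repeat_mset n y"
      \<comment> \<open>\<open>- n y\<close> in the cone means, after clearing signs, \<open>M + k x + n y \<preceq> M + k y\<close>.\<close>
      have step: "M + w \<preceq> M + repeat_mset k y"
        using add[OF MN, of w] eqm by (simp add: w_def add.assoc)
      have iter: "M + repeat_mset j w \<preceq> M + repeat_mset (j * k) y" for j
      proof (induction j)
        case 0 show ?case using refl by simp
      next
        case (Suc j)
        have "(M + w) + repeat_mset j w \<preceq> (M + repeat_mset k y) + repeat_mset j w" using add[OF step] .
        moreover have "(M + repeat_mset j w) + repeat_mset k y \<preceq> (M + repeat_mset (j * k) y) + repeat_mset k y"
          using add[OF Suc] .
        ultimately have "(M + w) + repeat_mset j w \<preceq> (M + repeat_mset (j * k) y) + repeat_mset k y"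
          using trans by (metis (no_types, lifting) add.assoc add.commute)
        moreover have "(M + repeat_mset (j * k) y) + repeat_mset k y = M + repeat_mset (Suc j * k) y"
          by (simp add: repeat_mset_distrib add.assoc add.commute)
        moreover have "(M + w) + repeat_mset j w = M + repeat_mset (Suc j) w" by (simp add: add.assoc)
        ultimately show ?case by simp
      qed
      obtain p where p: "M \<preceq> repeat_mset p y" using bound by blast
      \<comment> \<open>The multiset \<open>M\<close> cannot be cancelled in \<open>iter\<close>, but it is at most \<open>p y\<close> whatever \<open>j\<close> is.
          Taking \<open>j\<close> large, the surplus \<open>j n y\<close> dominates \<open>r\<close> copies of \<open>x\<close> with \<open>r > p + 1\<close>.\<close>
      obtain L where L: "x \<preceq> repeat_mset L y" using bound by blast
      define r where "r = p + 2"
      define j where "j = L * r"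
      have "repeat_mset (Suc (j * k + Suc p)) x = repeat_mset (j * k) x + repeat_mset r x"
        by (simp add: r_def flip: repeat_mset_distrib)
      also have "\<dots> \<preceq> repeat_mset (j * k) x + repeat_mset r (repeat_mset L y)"
        by (intro add2 refl rep L)
      also have "\<dots> \<preceq> repeat_mset (j * k) x + repeat_mset (j * n) y"
        using n by (intro add2 refl) (auto simp: j_def mult.commute intro!: mono)
      also have "\<dots> = repeat_mset j w" by (simp add: w_def repeat_mset_distrib2)
      also have "\<dots> \<preceq> M + repeat_mset j w" using add[OF pos, of "repeat_mset j w" M] by simp
      also have "\<dots> \<preceq> M + repeat_mset (j * k) y" by (rule iter)
      also have "\<dots> \<preceq> repeat_mset (Suc p) y + repeat_mset (j * k) y"
        by (intro add refl trans[OF p] mono) auto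
      finally have *: "repeat_mset (Suc (j * k + Suc p)) x \<preceq> repeat_mset (j * k + Suc p) y"
        by (simp add: repeat_mset_distrib add_ac)
      show False using noperf[of "j * k + Suc p"] * by simp
    qed
  qed blast
  have f0: "f 0 = 0" using f(1)[of 0 0] by simp
  have fdiff: "f (v - w) = f v - f w" for v w using f(1)[of "v - w" w] by simp
  define d where "d a = f (frag_of a)" for a
  have fe: "f (?e M) = (\<Sum>a\<in>#M. d a)" for M by (induction M) (auto simp: f0 f(1) d_def)
  show ?thesis
  proof (rule that)
    show "0 \<le> d a" for a using f(3)[OF CI[OF pos[of "{#a#}"]]] by (simp add: d_def)
    show "(\<Sum>a\<in>#M. d a) \<le> (\<Sum>a\<in>#N. d a)" if "M \<preceq> N" for M N
      using f(3)[OF CI[OF that]] by (simp add: fdiff fe)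
    show "(\<Sum>a\<in>#y. d a) = 1" using f(2) fe by simp
    have "?e x - ?e y \<in> C" unfolding C_def using refl[of "{#}"]
      by (intro CollectI exI[of _ "{#}"] exI[of _ 1]) auto
    then show "(\<Sum>a\<in>#x. d a) \<ge> 1" using f(3) by (force simp: fdiff fe f(2)[unfolded fe])
  qed
qed

section \<open>Shrinking in normal spaces and the algebra generated by open sets\<close>

lemma open_set_between:
  fixes V :: "'x::t4_space set"
  assumes "closed F" "open V" "F \<subseteq> V"
  obtains W where "open W" "F \<subseteq> W" "closure W \<subseteq> V"
proof -
  obtain W T where WT: "open W" "open T" "F \<subseteq> W" "- V \<subseteq> T" "W \<inter> T = {}"
    using t4_space[of F "- V"] assms by (metis Diff_disjoint closed_Compl Diff_eq disjoint_eq_subset_Compl double_complement)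
  have "closure W \<subseteq> - T" using WT by (intro closure_minimal) auto
  then show ?thesis using that WT by blast
qed

text \<open>
  Induction on the index set: the part of \<open>F\<close> not covered by the other sets is closed and lies in
  \<open>U a\<close>.  A neighbourhood \<open>W\<close> of it with closure in \<open>U a\<close> supplies \<open>K a\<close> and leaves \<open>F - W\<close> to the others.
\<close>

lemma closed_cover_shrinking:
  fixes U :: "'i \<Rightarrow> 'x::t4_space set"
  assumes "finite I" "\<And>i. i \<in> I \<Longrightarrow> open (U i)" "closed F" "F \<subseteq> (\<Union>i\<in>I. U i)"
  obtains K where "\<And>i. i \<in> I \<Longrightarrow> closed (K i)" "\<And>i. i \<in> I \<Longrightarrow> K i \<subseteq> U i" "F \<subseteq> (\<Union>i\<in>I. K i)"
proof -
  have "\<exists>K. (\<forall>i\<in>I. closed (K i) \<and> K i \<subseteq> U i) \<and> F \<subseteq> (\<Union>i\<in>I. K i)"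
    using assms
  proof (induction I arbitrary: F)
    case (insert a I)
    let ?R = "\<Union>i\<in>I. U i"
    have "open ?R" using insert.prems by auto
    then have "closed (F - ?R)" "open (U a)" "F - ?R \<subseteq> U a" using insert.prems closed_Diff[of F ?R] by auto
    then obtain W where W: "open W" "F - ?R \<subseteq> W" "closure W \<subseteq> U a" by (rule open_set_between)
    have "\<exists>K. (\<forall>i\<in>I. closed (K i) \<and> K i \<subseteq> U i) \<and> F - W \<subseteq> (\<Union>i\<in>I. K i)"
      by (rule insert.IH) (use insert.prems W in \<open>auto simp: closed_Diff\<close>)
    then obtain K where K: "\<forall>i\<in>I. closed (K i) \<and> K i \<subseteq> U i" "F - W \<subseteq> (\<Union>i\<in>I. K i)" by blast
    have "W \<subseteq> closure W" by (rule closure_subset)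
    with K W insert.hyps show ?case
      by (intro exI[of _ "K(a := closure W)"]) (auto 0 4)
  qed simp
  then show ?thesis using that by blast
qed

lemma algebra_open_algebra: "algebra UNIV (open_algebra :: 'x::topological_space set set)"
  unfolding open_algebra_def
  by (rule hull_in) (auto simp: algebra_iff_Un)

lemma open_in_open_algebra: "open U \<Longrightarrow> U \<in> open_algebra"
  unfolding open_algebra_def by (rule hull_inc) simp

lemma closed_in_open_algebra:
  fixes F :: "'x::topological_space set"
  assumes "closed F" shows "F \<in> open_algebra"
proof -
  interpret algebra UNIV "open_algebra :: 'x set set" by (rule algebra_open_algebra)
  have "UNIV - (- F) \<in> open_algebra" using assms by (intro compl_sets open_in_open_algebra) auto
  then show ?thesis by (simp add: Compl_eq_Diff_UNIV[symmetric])
qed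

text \<open>
  Sets that are \<open>F\<^sub>\<sigma>\<close> together with their complement form an algebra, and it contains the open
  sets of a metric space.  This reduces inner regularity to continuity from below.
\<close>

lemma open_algebra_fsigma:
  fixes B :: "'x::metric_space set"
  assumes "B \<in> open_algebra" shows "fsigma_in euclidean B"
proof -
  have "open_algebra \<subseteq> {B :: 'x set. fsigma_in euclidean B \<and> fsigma_in euclidean (- B)}"
    unfolding open_algebra_def
  proof (rule hull_minimal)
    have "fsigma_in euclidean U" if "open U" for U :: "'x set"
      using open_imp_fsigma_in[OF metrizable_space_euclidean] that open_openin by blast
    moreover have "fsigma_in euclidean (- U)" if "open U" for U :: "'x set"
      using that closed_Compl[of U] closed_closedin by (blast intro: closed_imp_fsigma_in)
    ultimately show "{U. open U} \<subseteq> {B :: 'x set. fsigma_in euclidean B \<and> fsigma_in euclidean (- B)}" by auto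
    show "algebra UNIV {B :: 'x set. fsigma_in euclidean B \<and> fsigma_in euclidean (- B)}"
      unfolding algebra_iff_Un Compl_eq_Diff_UNIV[symmetric]
      using fsigma_in_topspace[of euclidean]
      by (auto simp: fsigma_in_Un fsigma_in_Int)
  qed
  then show ?thesis using assms by blast
qed

lemma open_algebra_incseq_closed:
  fixes B :: "'x::metric_space set"
  assumes "B \<in> open_algebra"
  obtains K :: "nat \<Rightarrow> 'x set" where "\<And>n. closed (K n)" "incseq K" "(\<Union>n. K n) = B"
  using open_algebra_fsigma[OF assms] that
  unfolding fsigma_in_ascending incseq_Suc_iff by (auto simp flip: closed_closedin)

section \<open>From a content on open sets to a regular premeasure\<close>

text \<open>
  A content on the open sets of a compact metric space, finitely subadditive and superadditive on
  disjoint sets.  No continuity is assumed, and infinite values may occur.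
\<close>

locale open_content =
  fixes d :: "'x::metric_space set \<Rightarrow> ennreal"
  assumes compact_UNIV: "compact (UNIV :: 'x set)"
    and d_empty: "d {} = 0"
    and d_mono: "open A \<Longrightarrow> open B \<Longrightarrow> A \<subseteq> B \<Longrightarrow> d A \<le> d B"
    and d_Un: "open A \<Longrightarrow> open B \<Longrightarrow> d (A \<union> B) \<le> d A + d B"
    and d_disjoint: "open A \<Longrightarrow> open B \<Longrightarrow> A \<inter> B = {} \<Longrightarrow> d A + d B \<le> d (A \<union> B)"
begin

text \<open>
  The inner content restores continuity from below by testing a set on the open sets whose closure
  it contains; the outer content extends it to all sets.
\<close>

definition inner_content :: "'x set \<Rightarrow> ennreal" where
  "inner_content V = (SUP W\<in>{W. open W \<and> closure W \<subseteq> V}. d W)"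

definition outer_content :: "'x set \<Rightarrow> ennreal" where
  "outer_content B = (INF V\<in>{V. open V \<and> B \<subseteq> V}. inner_content V)"

lemma inner_upper: "open W \<Longrightarrow> closure W \<subseteq> V \<Longrightarrow> d W \<le> inner_content V"
  unfolding inner_content_def by (intro SUP_upper) auto

lemma inner_mono: "V \<subseteq> V' \<Longrightarrow> inner_content V \<le> inner_content V'"
  unfolding inner_content_def by (intro SUP_subset_mono) auto

lemma inner_le: "open V \<Longrightarrow> inner_content V \<le> d V"
  unfolding inner_content_def by (intro SUP_least d_mono) (use closure_subset in auto)

lemma inner_empty: "inner_content {} = 0"
  using inner_le[of "{}"] d_empty by simp

lemma d_UN_finite:
  assumes "finite I" "\<And>i. i \<in> I \<Longrightarrow> open (W i)"
  shows "d (\<Union>i\<in>I. W i) \<le> (\<Sum>i\<in>I. d (W i))"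
  using assms
proof (induction I)
  case (insert a I)
  have "d (\<Union>i\<in>insert a I. W i) \<le> d (W a) + d (\<Union>i\<in>I. W i)"
    using insert.prems by (auto intro!: d_Un)
  also have "\<dots> \<le> d (W a) + (\<Sum>i\<in>I. d (W i))" using insert by (intro add_left_mono) auto
  finally show ?case using insert.hyps by simp
qed (simp add: d_empty)

text \<open>
  Countable subadditivity comes from compactness: a set \<open>W\<close> with closure in the union is covered by
  finitely many open sets, each with closure in one of the \<open>V n\<close>.
\<close>

lemma inner_UN:
  fixes V :: "nat \<Rightarrow> 'x set"
  assumes op: "\<And>n. open (V n)"
  shows "inner_content (\<Union>n. V n) \<le> suminf (\<lambda>n. inner_content (V n))"
  unfolding inner_content_def[of "\<Union>n. V n"]
proof (rule SUP_least, clarify)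
  fix W assume W: "open W" "closure W \<subseteq> (\<Union>n. V n)"
  have "compact (closure W)" using compact_UNIV by (metis closed_closure compact_Int_closed inf_top_left)
  then obtain I where I: "finite I" "closure W \<subseteq> (\<Union>n\<in>I. V n)"
    using compactE_image[of "closure W" UNIV V] op W by auto
  obtain K where K: "\<And>i. i \<in> I \<Longrightarrow> closed (K i)" "\<And>i. i \<in> I \<Longrightarrow> K i \<subseteq> V i" "closure W \<subseteq> (\<Union>i\<in>I. K i)"
    using closed_cover_shrinking[of I V "closure W"] I op by auto
  have "\<exists>T. open T \<and> K i \<subseteq> T \<and> closure T \<subseteq> V i" if "i \<in> I" for i
    using open_set_between[of "K i" "V i"] K that op by metis
  then obtain T where T: "\<And>i. i \<in> I \<Longrightarrow> open (T i) \<and> K i \<subseteq> T i \<and> closure (T i) \<subseteq> V i" by metis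
  have "W \<subseteq> (\<Union>i\<in>I. T i)" using K(3) T closure_subset[of W] by blast
  then have "d W \<le> d (\<Union>i\<in>I. T i)" using W T by (intro d_mono) auto
  also have "\<dots> \<le> (\<Sum>i\<in>I. d (T i))" using T I by (intro d_UN_finite) auto
  also have "\<dots> \<le> (\<Sum>i\<in>I. inner_content (V i))" using T by (intro sum_mono inner_upper) auto
  also have "\<dots> \<le> suminf (\<lambda>n. inner_content (V n))" using I by (intro sum_le_suminf) auto
  finally show "d W \<le> suminf (\<lambda>n. inner_content (V n))" .
qed

lemma inner_disjoint:
  assumes "open V" "open V'" "V \<inter> V' = {}"
  shows "inner_content V + inner_content V' \<le> inner_content (V \<union> V')"
proof -
  have ne: "{W. open W \<and> closure W \<subseteq> T} \<noteq> {}" for T :: "'x set"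
    using open_empty by (metis (mono_tags, lifting) closure_empty empty_iff empty_subsetI mem_Collect_eq)
  have "d W + d W' \<le> inner_content (V \<union> V')"
    if "open W" "closure W \<subseteq> V" "open W'" "closure W' \<subseteq> V'" for W W'
  proof -
    have "W \<inter> W' = {}" using that assms closure_subset[of W] closure_subset[of W'] by blast
    then have "d W + d W' \<le> d (W \<union> W')" using that by (intro d_disjoint) auto
    also have "\<dots> \<le> inner_content (V \<union> V')" using that by (intro inner_upper) auto
    finally show ?thesis .
  qed
  then have "d W + inner_content V' \<le> inner_content (V \<union> V')" if "open W" "closure W \<subseteq> V" for W
    unfolding inner_content_def[of V'] ennreal_SUP_add_right[OF ne] using that by (intro SUP_least) auto
  then show ?thesis
    unfolding inner_content_def[of V] ennreal_SUP_add_left[OF ne, symmetric] by (intro SUP_least) auto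
qed

lemma outer_open: "open V \<Longrightarrow> outer_content V = inner_content V"
  unfolding outer_content_def by (intro antisym INF_lower INF_greatest inner_mono) auto

lemma outer_mono: "B \<subseteq> B' \<Longrightarrow> outer_content B \<le> outer_content B'"
  unfolding outer_content_def by (intro INF_superset_mono) auto

lemma outer_UN: "outer_content (\<Union>n. B n) \<le> suminf (\<lambda>n. outer_content (B n))" for B :: "nat \<Rightarrow> 'x set"
proof (rule ennreal_le_epsilon)
  fix e :: real assume e: "0 < e" and fin: "suminf (\<lambda>n. outer_content (B n)) < Orderings.top"
  have "outer_content (B n) < outer_content (B n) + e * (1/2)^Suc n" for n
    using e ennreal_suminf_lessD[OF fin] by (auto simp: less_top)
  then have "\<exists>V. open V \<and> B n \<subseteq> V \<and> inner_content V \<le> outer_content (B n) + e * (1/2)^Suc n" for n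
    unfolding outer_content_def INF_less_iff by (blast intro: less_imp_le)
  then obtain V where V: "\<And>n. open (V n)" "\<And>n. B n \<subseteq> V n"
    "\<And>n. inner_content (V n) \<le> outer_content (B n) + e * (1/2)^Suc n" by metis
  have "outer_content (\<Union>n. B n) \<le> outer_content (\<Union>n. V n)" using V by (intro outer_mono) auto
  also have "\<dots> \<le> suminf (\<lambda>n. inner_content (V n))" using V inner_UN[of V] by (simp add: outer_open open_UN)
  also have "\<dots> \<le> suminf (\<lambda>n. outer_content (B n) + e * (1/2)^Suc n)" by (intro suminf_le V) auto
  also have "\<dots> = suminf (\<lambda>n. outer_content (B n)) + suminf (\<lambda>n. ennreal e * ennreal ((1/2) ^ Suc n))"
    using e by (subst suminf_add[symmetric])
      (auto simp del: ennreal_suminf_cmult simp add: ennreal_mult[symmetric])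
  also have "\<dots> = suminf (\<lambda>n. outer_content (B n)) + e"
    unfolding ennreal_suminf_cmult
    by (subst suminf_ennreal_eq[OF zero_le_power power_half_series]) auto
  finally show "outer_content (\<Union>n. B n) \<le> suminf (\<lambda>n. outer_content (B n)) + e" .
qed

lemma outer_empty: "outer_content {} = 0" by (simp add: outer_open inner_empty)

lemma outer_measure_space_outer: "outer_measure_space (Pow UNIV) outer_content"
  unfolding outer_measure_space_def
  by (auto simp: positive_def increasing_def countably_subadditive_def outer_empty outer_mono outer_UN)

lemma outer_Un: "outer_content (A \<union> B) \<le> outer_content A + outer_content B"
proof -
  have "subadditive (Pow UNIV) outer_content" if "ring_of_sets UNIV (Pow UNIV :: 'x set set)"
    using ring_of_sets.countably_subadditive_subadditive[OF that] outer_measure_space_outer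
    unfolding outer_measure_space_def by blast
  then have "subadditive (Pow UNIV) outer_content"
    using algebra.axioms(1) sigma_algebra_Pow sigma_algebra.axioms(1) by blast
  then have "outer_content (A \<union> (B - A)) \<le> outer_content A + outer_content (B - A)" 
    unfolding subadditive_def by blast
  also have "\<dots> \<le> outer_content A + outer_content B" by (intro add_left_mono outer_mono) auto
  finally show ?thesis by simp
qed

text \<open>
  Up to its inner content, \<open>S \<inter> V\<close> is exhausted by open sets with closure in \<open>S \<inter> V\<close>, for any open \<open>S\<close>
  containing \<open>T\<close>.  The rest of \<open>S\<close> outside such a closure is open and contains \<open>T - V\<close>, so that
  superadditivity on disjoint open sets applies.
\<close>

lemma open_caratheodory:
  assumes V: "open V"
  shows "outer_content (V \<inter> T) + outer_content (T - V) \<le> outer_content T"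
  unfolding outer_content_def[of T]
proof (rule INF_greatest, clarify)
  fix S assume S: "open S" "T \<subseteq> S"
  have ne: "{W. open W \<and> closure W \<subseteq> S \<inter> V} \<noteq> {}"
    using open_empty by (metis (mono_tags, lifting) closure_empty empty_iff empty_subsetI mem_Collect_eq)
  have *: "d W + outer_content (T - V) \<le> inner_content S" if W: "open W" "closure W \<subseteq> S \<inter> V" for W
  proof -
    \<comment> \<open>The intermediate \<open>W'\<close> is needed because \<open>d W\<close> is bounded by the inner content of a
        neighbourhood of the closure of \<open>W\<close>, not by that of \<open>W\<close> itself.\<close>
    obtain W' where W': "open W'" "closure W \<subseteq> W'" "closure W' \<subseteq> S \<inter> V"
      using open_set_between[of "closure W" "S \<inter> V"] W S V by auto
    have "d W \<le> inner_content W'" using W W' by (intro inner_upper)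
    moreover have "outer_content (T - V) \<le> inner_content (S - closure W')"
      using S W' by (subst outer_open[symmetric]) (auto intro!: outer_mono)
    ultimately have "d W + outer_content (T - V) \<le> inner_content W' + inner_content (S - closure W')" by (rule add_mono)
    also have "\<dots> \<le> inner_content (W' \<union> (S - closure W'))"
      using S W' closure_subset[of W'] by (intro inner_disjoint) auto
    also have "\<dots> \<le> inner_content S" using W' closure_subset[of W'] by (intro inner_mono) auto
    finally show ?thesis .
  qed
  have "outer_content (V \<inter> T) \<le> inner_content (S \<inter> V)"
    using S V by (subst outer_open[symmetric]) (auto intro!: outer_mono)
  then have "outer_content (V \<inter> T) + outer_content (T - V) \<le> inner_content (S \<inter> V) + outer_content (T - V)" by (rule add_right_mono)
  also have "\<dots> \<le> inner_content S"
    unfolding inner_content_def[of "S \<inter> V"] ennreal_SUP_add_left[OF ne, symmetric]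
    using * by (intro SUP_least) auto
  finally show "outer_content (V \<inter> T) + outer_content (T - V) \<le> inner_content S" .
qed

lemma open_algebra_measurable: "open_algebra \<subseteq> lambda_system UNIV (Pow UNIV) outer_content"
proof -
  interpret sigma_algebra UNIV "Pow UNIV :: 'x set set" by (rule sigma_algebra_Pow)
  have "measure_space UNIV (lambda_system UNIV (Pow UNIV) outer_content) outer_content"
    by (rule caratheodory_lemma[OF outer_measure_space_outer])
  then have "algebra UNIV (lambda_system UNIV (Pow UNIV) outer_content)"
    by (auto simp: measure_space_def dest: sigma_algebra.axioms(1))
  moreover have "U \<in> lambda_system UNIV (Pow UNIV) outer_content" if "open U" for U
    unfolding lambda_system_def
  proof (clarsimp, rule antisym)
    fix T
    have "T = (U \<inter> T) \<union> ((UNIV - U) \<inter> T)" by auto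
    then show "outer_content T \<le> outer_content (U \<inter> T) + outer_content ((UNIV - U) \<inter> T)" using outer_Un by metis
    have "(UNIV - U) \<inter> T = T - U" by auto
    then show "outer_content (U \<inter> T) + outer_content ((UNIV - U) \<inter> T) \<le> outer_content T"
      using open_caratheodory[OF that] by simp
  qed
  ultimately show ?thesis unfolding open_algebra_def by (intro hull_minimal) auto
qed

lemma positive_outer: "positive M outer_content"
  by (simp add: positive_def outer_empty)

lemma countably_additive_outer: "countably_additive open_algebra outer_content"
proof -
  interpret sigma_algebra UNIV "Pow UNIV :: 'x set set" by (rule sigma_algebra_Pow)
  have "countably_additive (lambda_system UNIV (Pow UNIV) outer_content) outer_content"
    using caratheodory_lemma[OF outer_measure_space_outer] by (simp add: measure_space_def)
  then show ?thesis using open_algebra_measurable unfolding countably_additive_def by blast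
qed

text \<open>
  Every set of the algebra is an increasing union of compact sets, so inner regularity holds
  also for sets of infinite content.
\<close>

lemma outer_inner_regular:
  assumes B: "B \<in> open_algebra"
  shows "outer_content B = (SUP F\<in>{F. F \<subseteq> B \<and> compact F}. outer_content F)"
proof (rule antisym)
  obtain K where K: "\<And>n. closed (K n)" "incseq K" "(\<Union>n. K n) = B" using open_algebra_incseq_closed[OF B] by blast
  interpret algebra UNIV "open_algebra :: 'x set set" by (rule algebra_open_algebra)
  have "(\<lambda>n. outer_content (K n)) \<longlonglongrightarrow> outer_content (\<Union>n. K n)"
    using countably_additive_iff_continuous_from_below[OF positive_outer
        countably_additive_additive[OF positive_outer countably_additive_outer]]
      countably_additive_outer K B closed_in_open_algebra by blast
  moreover have "outer_content (K n) \<le> (SUP F\<in>{F. F \<subseteq> B \<and> compact F}. outer_content F)" for n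
  proof (rule SUP_upper)
    have "compact (K n)" using compact_UNIV K(1) by (metis compact_Int_closed inf_top_left)
    then show "K n \<in> {F. F \<subseteq> B \<and> compact F}" using K(3) by blast
  qed
  ultimately show "outer_content B \<le> (SUP F\<in>{F. F \<subseteq> B \<and> compact F}. outer_content F)"
    using K(3) by (auto intro: LIMSEQ_le_const2)
qed (auto intro!: SUP_least outer_mono)

lemma outer_outer_regular: "outer_content B = (INF V\<in>{V. B \<subseteq> V \<and> open V}. outer_content V)"
  unfolding outer_content_def[of B] by (intro INF_cong) (auto simp: outer_open)

end

text \<open>
  The inner and outer contents are determined by \<open>d\<close> and the topology, so a homeomorphism that
  preserves \<open>d\<close> preserves them as well.  This is one inequality; the other is its instance for the
  inverse map.
\<close>

lemma (in open_content) outer_homeomorphism_le: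
  assumes hk: "\<And>x. k (h x) = x" "\<And>x. h (k x) = x"
    and cont: "continuous_on UNIV h" "continuous_on UNIV k"
    and inv: "\<And>W. open W \<Longrightarrow> d (k ` W) = d W"
  shows "outer_content (h ` B) \<le> outer_content B"
proof -
  have im: "h ` A = k -` A" "k ` A = h -` A" for A using hk by (auto simp: image_iff) metis+
  have op: "open (h ` A)" "open (k ` A)" if "open A" for A
    unfolding im using cont that by (auto intro: open_vimage)
  have cl: "closure (k ` W) \<subseteq> V" if "closure W \<subseteq> h ` V" for V W
  proof -
    have "closed (h -` closure W)" using cont by (intro closed_vimage) auto
    then have "closure (k ` W) \<subseteq> h -` closure W"
      using closure_subset[of W] by (intro closure_minimal) (auto simp: im)
    also have "\<dots> \<subseteq> V" using that hk(1) by (auto simp: im)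
    finally show ?thesis .
  qed
  have inner_le: "inner_content (h ` V) \<le> inner_content V" for V
    unfolding inner_content_def[of "h ` V"]
  proof (rule SUP_least, clarify)
    fix W assume "open W" "closure W \<subseteq> h ` V"
    then show "d W \<le> inner_content V" using inner_upper[OF op(2) cl] inv by metis
  qed
  show ?thesis
    unfolding outer_content_def
  proof (rule INF_mono, clarify)
    fix V assume "open V" "B \<subseteq> V"
    then show "\<exists>V'\<in>{V. open V \<and> h ` B \<subseteq> V}. inner_content V' \<le> inner_content V"
      using op inner_le by (intro bexI[of _ "h ` V"]) auto
  qed
qed

lemma (in open_content) outer_homeomorphism:
  assumes hk: "\<And>x. k (h x) = x" "\<And>x. h (k x) = x"
    and cont: "continuous_on UNIV h" "continuous_on UNIV k"
    and inv: "\<And>W. open W \<Longrightarrow> d (h ` W) = d W"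
  shows "outer_content (h ` B) = outer_content B"
proof (rule antisym)
  have im: "h ` A = k -` A" "k ` A = h -` A" for A using hk by (auto simp: image_iff) metis+
  have "d (k ` W) = d W" if "open W" for W
  proof -
    have "open (k ` W)" unfolding im using cont that by (auto intro: open_vimage)
    then have "d (h ` k ` W) = d (k ` W)" by (rule inv)
    then show ?thesis using hk by (simp add: image_image)
  qed
  then show "outer_content (h ` B) \<le> outer_content B" using outer_homeomorphism_le[of k h] hk cont by blast
  have "outer_content (k ` h ` B) \<le> outer_content (h ` B)" using outer_homeomorphism_le[of h k] hk cont inv by blast
  then show "outer_content B \<le> outer_content (h ` B)" using hk by (simp add: image_image)
qed

lemma (in open_content) scaled_content: "open_content (\<lambda>A. c * d A)"
  by unfold_locales
    (auto simp: compact_UNIV d_empty d_mono d_Un d_disjoint mult_left_mono simp flip: distrib_left)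

lemma (in open_content) outer_scaled_open:
  "open V \<Longrightarrow> open_content.outer_content (\<lambda>A. c * d A) V = c * outer_content V"
  by (simp add: outer_open open_content.outer_open[OF scaled_content]
      inner_content_def open_content.inner_content_def[OF scaled_content] SUP_mult_left_ennreal)

lemma (in open_content) outer_invariant_premeasure:
  fixes G :: "('g, 'm) monoid_scheme" and \<phi> :: "'g \<Rightarrow> 'x \<Rightarrow> 'x"
  assumes "\<And>g. g \<in> carrier G \<Longrightarrow> \<exists>k. continuous_on UNIV k \<and> (\<forall>x. k (\<phi> g x) = x) \<and> (\<forall>x. \<phi> g (k x) = x)"
    "\<And>g. g \<in> carrier G \<Longrightarrow> continuous_on UNIV (\<phi> g)"
    "\<And>g W. g \<in> carrier G \<Longrightarrow> open W \<Longrightarrow> d (\<phi> g ` W) = d W"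
  shows "outer_content \<in> invariant_premeasures G \<phi>"
proof -
  have "outer_content (\<phi> g ` B) = outer_content B" if "g \<in> carrier G" for g B
  proof -
    obtain k where k: "continuous_on UNIV k" "\<And>x. k (\<phi> g x) = x" "\<And>x. \<phi> g (k x) = x"
      using assms(1)[OF \<open>g \<in> carrier G\<close>] by blast
    show ?thesis
      by (rule outer_homeomorphism[of k]) (use k assms that in auto)
  qed
  moreover have "outer_content B = (SUP F\<in>{F. F \<subseteq> B \<and> compact F}. outer_content F) \<and> outer_content B = (INF V\<in>{V. B \<subseteq> V \<and> open V}. outer_content V)"
    if "B \<in> open_algebra" for B
    using outer_inner_regular[OF that] outer_outer_regular[of B] by (rule conjI)
  ultimately show ?thesis
    unfolding invariant_premeasures_def mem_Collect_eq
    using positive_outer countably_additive_outer by blast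
qed

section \<open>Dynamical subequivalence by finite families of pieces\<close>

locale compact_action =
  fixes G :: "('g, 'm) monoid_scheme" and \<phi> :: "'g \<Rightarrow> 'x::metric_space \<Rightarrow> 'x"
  assumes compact_space: "compact (UNIV :: 'x set)" and action: "continuous_action G \<phi>"
begin

lemma group_act: "group_action G UNIV \<phi>"
  using action by (simp add: continuous_action_def)

lemma group_G: "group G"
  using group_act by (simp add: group_action_def group_hom_def)

lemma act_mult: "s \<in> carrier G \<Longrightarrow> t \<in> carrier G \<Longrightarrow> \<phi> (s \<otimes>\<^bsub>G\<^esub> t) x = \<phi> s (\<phi> t x)"
  using group_action.composition_rule[OF group_act] by simp

lemma act_one: "\<phi> \<one>\<^bsub>G\<^esub> x = x"
  using group_action.id_eq_one[OF group_act] by (metis UNIV_I restrict_apply')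

lemma act_inv: "s \<in> carrier G \<Longrightarrow> \<phi> (inv\<^bsub>G\<^esub> s) (\<phi> s x) = x" "s \<in> carrier G \<Longrightarrow> \<phi> s (\<phi> (inv\<^bsub>G\<^esub> s) x) = x"
  using group_G by (metis act_mult act_one group.inv_closed group.l_inv group.r_inv)+

lemma inv_in: "s \<in> carrier G \<Longrightarrow> inv\<^bsub>G\<^esub> s \<in> carrier G" and one_in: "\<one>\<^bsub>G\<^esub> \<in> carrier G"
  and mult_in: "s \<in> carrier G \<Longrightarrow> t \<in> carrier G \<Longrightarrow> s \<otimes>\<^bsub>G\<^esub> t \<in> carrier G"
  using group_G by (auto simp: group.is_monoid monoid.m_closed)

lemma act_bij: "s \<in> carrier G \<Longrightarrow> bij (\<phi> s)"
  by (rule o_bij[of "\<phi> (inv\<^bsub>G\<^esub> s)"]) (auto simp: act_inv)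

lemma act_continuous: "s \<in> carrier G \<Longrightarrow> continuous_on UNIV (\<phi> s)"
proof -
  assume s: "s \<in> carrier G"
  have "continuous_map euclidean (prod_topology (discrete_topology (carrier G)) euclidean) (\<lambda>x. (s, x))"
    using s by (intro continuous_map_pairedI) auto
  then have "continuous_map euclidean euclidean ((\<lambda>(g, x). \<phi> g x) \<circ> (\<lambda>x. (s, x)))"
    using action unfolding continuous_action_def by (blast intro: continuous_map_compose)
  then show ?thesis by (simp add: comp_def)
qed

lemma act_image: "s \<in> carrier G \<Longrightarrow> \<phi> s ` A = {x. \<phi> (inv\<^bsub>G\<^esub> s) x \<in> A}"
  by (force simp: act_inv image_iff)

lemma act_open: "s \<in> carrier G \<Longrightarrow> open U \<Longrightarrow> open (\<phi> s ` U)"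
  using open_vimage[OF _ act_continuous[OF inv_in]] by (simp add: act_image vimage_def)

lemma act_closed: "s \<in> carrier G \<Longrightarrow> closed U \<Longrightarrow> closed (\<phi> s ` U)"
  using closed_vimage[OF _ act_continuous[OF inv_in]] by (simp add: act_image vimage_def)

text \<open>
  A piece \<open>(i, U, s, k)\<close> is an open subset \<open>U\<close> of the \<open>i\<close>-th source set, moved by \<open>s\<close> into the \<open>k\<close>-th
  target set.  A finite set of pieces replaces the doubly indexed families in the definition of
  the relation, so that no enumeration has to be carried along.  Pieces that coincide as tuples may
  be identified, since disjointness makes repeated nonempty pieces impossible.
\<close>

definition piece_family :: "nat \<Rightarrow> 'x set list \<Rightarrow> (nat \<times> 'x set \<times> 'g \<times> nat) set \<Rightarrow> bool" where
  "piece_family n Vs P \<longleftrightarrow> finite P \<and>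
     (\<forall>i U s k. (i, U, s, k) \<in> P \<longrightarrow>
        i < n \<and> open U \<and> s \<in> carrier G \<and> k < length Vs \<and> \<phi> s ` U \<subseteq> Vs ! k) \<and>
     (\<forall>i U s i' U' s' k. (i, U, s, k) \<in> P \<longrightarrow> (i', U', s', k) \<in> P \<longrightarrow>
        \<phi> s ` U \<inter> \<phi> s' ` U' \<noteq> {} \<longrightarrow> i = i' \<and> U = U' \<and> s = s')"

lemma piece_familyI:
  assumes "finite P"
    "\<And>i U s k. (i, U, s, k) \<in> P \<Longrightarrow> i < n \<and> open U \<and> s \<in> carrier G \<and> k < length Vs \<and> \<phi> s ` U \<subseteq> Vs ! k"
    "\<And>i U s i' U' s' k. (i, U, s, k) \<in> P \<Longrightarrow> (i', U', s', k) \<in> P \<Longrightarrow> \<phi> s ` U \<inter> \<phi> s' ` U' \<noteq> {} \<Longrightarrow>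
        i = i' \<and> U = U' \<and> s = s'"
  shows "piece_family n Vs P"
proof -
  have "\<forall>i U s k. (i, U, s, k) \<in> P \<longrightarrow>
      i < n \<and> open U \<and> s \<in> carrier G \<and> k < length Vs \<and> \<phi> s ` U \<subseteq> Vs ! k"
    by (intro allI impI) (rule assms(2))
  moreover have "\<forall>i U s i' U' s' k. (i, U, s, k) \<in> P \<longrightarrow> (i', U', s', k) \<in> P \<longrightarrow>
      \<phi> s ` U \<inter> \<phi> s' ` U' \<noteq> {} \<longrightarrow> i = i' \<and> U = U' \<and> s = s'"
    by (intro allI impI) (rule assms(3))
  ultimately show ?thesis unfolding piece_family_def using assms(1) by (intro conjI)
qed

lemma piece_familyD:
  assumes "piece_family n Vs P"
  shows "finite P" and "(i, U, s, k) \<in> P \<Longrightarrow> i < n" and "(i, U, s, k) \<in> P \<Longrightarrow> open U"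
    and "(i, U, s, k) \<in> P \<Longrightarrow> s \<in> carrier G" and "(i, U, s, k) \<in> P \<Longrightarrow> k < length Vs"
    and "(i, U, s, k) \<in> P \<Longrightarrow> \<phi> s ` U \<subseteq> Vs ! k"
    and "(i, U, s, k) \<in> P \<Longrightarrow> (i', U', s', k) \<in> P \<Longrightarrow> \<phi> s ` U \<inter> \<phi> s' ` U' \<noteq> {} \<Longrightarrow>
        i = i' \<and> U = U' \<and> s = s'"
  using assms unfolding piece_family_def by meson+

definition layer :: "(nat \<times> 'x set \<times> 'g \<times> nat) set \<Rightarrow> nat \<Rightarrow> 'x set" where
  "layer P i = \<Union>{U. \<exists>s k. (i, U, s, k) \<in> P}"

lemma dyn_subequiv_iff_pieces:
  "dyn_subequiv G \<phi> Os Vs \<longleftrightarrow>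
     (\<forall>F. (\<forall>i<length Os. closed (F i) \<and> F i \<subseteq> Os ! i) \<longrightarrow>
        (\<exists>P. piece_family (length Os) Vs P \<and> (\<forall>i<length Os. F i \<subseteq> layer P i)))"
proof -
  have tag: "A \<times> {k} \<subseteq> tagged_union Vs \<longleftrightarrow> A \<subseteq> Vs ! k" if "k < length Vs" for A k
    using that by (auto simp: tagged_union_def)
  have 1: "\<exists>P. piece_family (length Os) Vs P \<and> (\<forall>i<length Os. F i \<subseteq> layer P i)"
    if cov: "\<forall>i<length Os. F i \<subseteq> (\<Union>j<J i. U i j) \<and>
             (\<forall>j<J i. open (U i j) \<and> s i j \<in> carrier G \<and> k i j < length Vs \<and>
                (\<phi> (s i j) ` U i j) \<times> {k i j} \<subseteq> tagged_union Vs)"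
      and dis: "disjoint_family_on (\<lambda>(i, j). (\<phi> (s i j) ` U i j) \<times> {k i j})
            (SIGMA i:{..<length Os}. {..<J i})" for F :: "nat \<Rightarrow> 'x set" and J :: "nat \<Rightarrow> nat" and U s k
  proof (intro exI conjI allI impI)
    have pr: "open (U i j) \<and> s i j \<in> carrier G \<and> k i j < length Vs \<and> (\<forall>x\<in>U i j. \<phi> (s i j) x \<in> Vs ! k i j)"
      if "i < length Os" "j < J i" for i j
      using cov tag[of "k i j" "\<phi> (s i j) ` U i j"] that by auto
    let ?P = "(\<lambda>(i, j). (i, U i j, s i j, k i j)) ` (SIGMA i:{..<length Os}. {..<J i})"
    show "piece_family (length Os) Vs ?P"
    proof (rule piece_familyI)
      show "i < length Os \<and> open V \<and> t \<in> carrier G \<and> l < length Vs \<and> \<phi> t ` V \<subseteq> Vs ! l"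
        if "(i, V, t, l) \<in> ?P" for i V t l using that pr by (auto simp: image_subset_iff)
      fix i V t i' V' t' l
      assume a: "(i, V, t, l) \<in> ?P" "(i', V', t', l) \<in> ?P" and ne: "\<phi> t ` V \<inter> \<phi> t' ` V' \<noteq> {}"
      obtain j where j: "j < J i" "i < length Os" "V = U i j" "t = s i j" "l = k i j" using a(1) by auto
      obtain j' where j': "j' < J i'" "i' < length Os" "V' = U i' j'" "t' = s i' j'" "l = k i' j'" using a(2) by auto
      have "(i, j) = (i', j')"
        using disjoint_family_onD[OF dis, of "(i, j)" "(i', j')"] j j' ne by blast
      then show "i = i' \<and> V = V' \<and> t = t'" using j j' by simp
    qed (intro finite_imageI finite_SigmaI; simp)
    show "F i \<subseteq> layer ?P i" if "i < length Os" for i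
    proof -
      have "U i j \<subseteq> layer ?P i" if "j < J i" for j
        unfolding layer_def using that \<open>i < length Os\<close> by (intro Union_upper) force
      then show ?thesis using cov that by blast
    qed
  qed
  have 2: "\<exists>(J :: nat \<Rightarrow> nat) (U :: nat \<Rightarrow> nat \<Rightarrow> 'x set) (s :: nat \<Rightarrow> nat \<Rightarrow> 'g)
          (k :: nat \<Rightarrow> nat \<Rightarrow> nat).
          (\<forall>i<length Os.
             F i \<subseteq> (\<Union>j<J i. U i j) \<and>
             (\<forall>j<J i. open (U i j) \<and> s i j \<in> carrier G \<and> k i j < length Vs \<and>
                (\<phi> (s i j) ` U i j) \<times> {k i j} \<subseteq> tagged_union Vs)) \<and>
          disjoint_family_on (\<lambda>(i, j). (\<phi> (s i j) ` U i j) \<times> {k i j})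
            (SIGMA i:{..<length Os}. {..<J i})"
    if P: "piece_family (length Os) Vs P" and cov: "\<forall>i<length Os. F i \<subseteq> layer P i" for F P
  proof -
    define Q where "Q i = {(U, s, k). (i, U, s, k) \<in> P}" for i
    have "finite (Q i)" for i
    proof (rule finite_subset)
      show "Q i \<subseteq> snd ` P" unfolding Q_def by force
    qed (use P in \<open>auto simp: piece_family_def\<close>)
    then have "\<exists>e. bij_betw e {..<card (Q i)} (Q i)" for i
      using ex_bij_betw_nat_finite[of "Q i"] by (simp add: lessThan_atLeast0)
    then obtain e where e: "\<And>i. bij_betw (e i) {..<card (Q i)} (Q i)" by metis
    let ?J = "\<lambda>i. card (Q i)" and ?U = "\<lambda>i j. fst (e i j)" and ?s = "\<lambda>i j. fst (snd (e i j))" and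
      ?k = "\<lambda>i j. snd (snd (e i j))"
    have eP: "(i, ?U i j, ?s i j, ?k i j) \<in> P" if "j < ?J i" for i j
    proof -
      have "e i j \<in> Q i" using e that by (auto simp: bij_betw_def)
      then show ?thesis by (auto simp: Q_def split: prod.splits)
    qed
    show ?thesis
    proof (intro exI[of _ ?J] exI[of _ ?U] exI[of _ ?s] exI[of _ ?k] conjI allI impI)
      show "F i \<subseteq> (\<Union>j<card (Q i). fst (e i j))" if "i < length Os" for i
      proof
        fix x assume "x \<in> F i"
        then obtain U s k where U: "(i, U, s, k) \<in> P" "x \<in> U" using cov \<open>i < length Os\<close> unfolding layer_def by blast
        then have "(U, s, k) \<in> e i ` {..<?J i}" using e[of i] by (simp add: Q_def bij_betw_def)
        then obtain j where "j < ?J i" "e i j = (U, s, k)" by (metis imageE lessThan_iff)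
        then show "x \<in> (\<Union>j<card (Q i). fst (e i j))" using U by force
      qed
      fix i j assume ij: "i < length Os" "j < ?J i"
      show "open (?U i j)" "?s i j \<in> carrier G" and k: "?k i j < length Vs"
        using piece_familyD(3-5)[OF P eP[OF ij(2)]] .
      show "(\<phi> (?s i j) ` ?U i j) \<times> {?k i j} \<subseteq> tagged_union Vs"
        using piece_familyD(6)[OF P eP[OF ij(2)]] unfolding tag[OF k] .
    next
      show "disjoint_family_on (\<lambda>(i, j). (\<phi> (?s i j) ` ?U i j) \<times> {?k i j}) (SIGMA i:{..<length Os}. {..<?J i})"
        unfolding disjoint_family_on_def
      proof (clarsimp simp del: Int_iff)
        fix i j i' j' assume ij: "j < ?J i" "j' < ?J i'" "i = i' \<longrightarrow> j \<noteq> j'"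
        have "(i, ?U i j, ?s i j, ?k i j) \<noteq> (i', ?U i' j', ?s i' j', ?k i' j')"
        proof
          assume eq: "(i, ?U i j, ?s i j, ?k i j) = (i', ?U i' j', ?s i' j', ?k i' j')"
          then have "e i j = e i j'" by (auto simp: prod_eq_iff)
          then show False using ij eq e[of i] by (auto simp: bij_betw_def inj_on_def)
        qed
        then have "?k i j = ?k i' j' \<longrightarrow> \<phi> (?s i j) ` ?U i j \<inter> \<phi> (?s i' j') ` ?U i' j' = {}"
          using piece_familyD(7)[OF P] eP[OF ij(1)] eP[OF ij(2)] by metis
        then show "\<phi> (?s i j) ` ?U i j \<times> {?k i j} \<inter> \<phi> (?s i' j') ` ?U i' j' \<times> {?k i' j'} = {}" by auto
      qed
    qed
  qed
  show ?thesis
    unfolding dyn_subequiv_def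
    by (intro iffI allI impI) (drule spec, drule (1) mp, (elim exE conjE)?, (rule 1 2; assumption))+
qed

lemma dyn_subequivI:
  assumes "piece_family (length Os) Vs P" "\<And>i. i < length Os \<Longrightarrow> Os ! i \<subseteq> layer P i"
  shows "dyn_subequiv G \<phi> Os Vs"
  unfolding dyn_subequiv_iff_pieces using assms by blast

text \<open>
  The closed sets tested by \<open>F\<close> are cut into closed subsets \<open>K p\<close> of the pieces \<open>p\<close>.  The translates
  of these form closed subsets \<open>F' l\<close> of the intermediate sets, to which the second relation
  applies.  Composing pieces, \<open>(i, U, s, k)\<close> followed by \<open>(k, U', s', l)\<close> is the part of \<open>U\<close> that \<open>s\<close> moves
  into \<open>U'\<close>.
\<close>

lemma dyn_subequiv_trans:
  assumes OV: "dyn_subequiv G \<phi> Os Vs" and VW: "dyn_subequiv G \<phi> Vs Ws"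
  shows "dyn_subequiv G \<phi> Os Ws"
  unfolding dyn_subequiv_iff_pieces
proof (intro allI impI)
  fix F assume F: "\<forall>i<length Os. closed (F i) \<and> F i \<subseteq> Os ! i"
  then obtain P where P: "piece_family (length Os) Vs P" "\<And>i. i < length Os \<Longrightarrow> F i \<subseteq> layer P i"
    using OV unfolding dyn_subequiv_iff_pieces by meson
  have finP: "finite P" using P by (simp add: piece_family_def)
  have Pin: "i < length Os" "open U" "s \<in> carrier G" "k < length Vs" "\<phi> s ` U \<subseteq> Vs ! k" if "(i, U, s, k) \<in> P" for i U s k
    using piece_familyD(2-6)[OF P(1) that] .
  define shrinks where "shrinks i K \<longleftrightarrow> (\<forall>p\<in>{p\<in>P. fst p = i}. closed (K p) \<and> K p \<subseteq> fst (snd p)) \<and>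
      F i \<subseteq> (\<Union>p\<in>{p\<in>P. fst p = i}. K p)" for i and K :: "nat \<times> 'x set \<times> 'g \<times> nat \<Rightarrow> 'x set"
  have "\<exists>K. shrinks i K" if "i < length Os" for i
  proof -
    have "F i \<subseteq> (\<Union>p\<in>{p\<in>P. fst p = i}. fst (snd p))" using P(2)[OF that] unfolding layer_def by force
    moreover have "open (fst (snd p))" if "p \<in> {p\<in>P. fst p = i}" for p using that Pin(2) by (cases p) auto
    moreover have "finite {p\<in>P. fst p = i}" "closed (F i)" using finP F that by auto
    ultimately obtain K where "\<And>p. p \<in> {p\<in>P. fst p = i} \<Longrightarrow> closed (K p)"
      "\<And>p. p \<in> {p\<in>P. fst p = i} \<Longrightarrow> K p \<subseteq> fst (snd p)" "F i \<subseteq> (\<Union>p\<in>{p\<in>P. fst p = i}. K p)"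
      using closed_cover_shrinking[of "{p\<in>P. fst p = i}" "\<lambda>p. fst (snd p)" "F i"] by blast
    then show ?thesis unfolding shrinks_def by blast
  qed
  then obtain K' where sK': "\<And>i. i < length Os \<Longrightarrow> shrinks i (K' i)" by metis
  have K': "\<And>p. p \<in> P \<Longrightarrow> fst p < length Os \<Longrightarrow> closed (K' (fst p) p) \<and> K' (fst p) p \<subseteq> fst (snd p)"
    "\<And>i. i < length Os \<Longrightarrow> F i \<subseteq> (\<Union>p\<in>{p\<in>P. fst p = i}. K' i p)"
    using sK' unfolding shrinks_def by blast+
  define K where "K p = K' (fst p) p" for p
  have K: "closed (K p)" "K p \<subseteq> fst (snd p)" if "p \<in> P" for p
    using K'(1)[of p] that Pin(1) unfolding K_def by (cases p; auto)+
  have KF: "F i \<subseteq> (\<Union>p\<in>{p\<in>P. fst p = i}. K p)" if "i < length Os" for i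
    using K'(2)[OF that] unfolding K_def by auto
  define F' where "F' l = (\<Union>p\<in>{p\<in>P. snd (snd (snd p)) = l}. \<phi> (fst (snd (snd p))) ` K p)" for l
  have "closed (F' l)" for l
    unfolding F'_def using finP K Pin(3) by (intro closed_UN) (auto intro!: act_closed)
  moreover have "F' l \<subseteq> Vs ! l" for l
    unfolding F'_def using K(2) Pin(5) by fastforce
  ultimately obtain P' where P': "piece_family (length Vs) Ws P'" "\<And>l. l < length Vs \<Longrightarrow> F' l \<subseteq> layer P' l"
    using VW unfolding dyn_subequiv_iff_pieces by meson
  have finP': "finite P'" using P' by (simp add: piece_family_def)
  have P'in: "open U" "s \<in> carrier G" "k < length Ws" "\<phi> s ` U \<subseteq> Ws ! k" if "(i, U, s, k) \<in> P'" for i U s k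
    using piece_familyD(3-6)[OF P'(1) that] .
  define Q where "Q = (\<lambda>((i, U, s, k), (k', U', s', l)). (i, U \<inter> \<phi> s -` U', s' \<otimes>\<^bsub>G\<^esub> s, l)) `
     {(p, p'). p \<in> P \<and> p' \<in> P' \<and> snd (snd (snd p)) = fst p'}"
  have Qiff: "q \<in> Q \<longleftrightarrow> (\<exists>i U s k U' s' l. (i, U, s, k) \<in> P \<and> (k, U', s', l) \<in> P' \<and>
      q = (i, U \<inter> \<phi> s -` U', s' \<otimes>\<^bsub>G\<^esub> s, l))" for q
    unfolding Q_def by (force simp: image_iff)
  have im: "\<phi> (s' \<otimes>\<^bsub>G\<^esub> s) ` (U \<inter> \<phi> s -` U') \<subseteq> \<phi> s' ` (\<phi> s ` U \<inter> U')"
    if "s \<in> carrier G" "s' \<in> carrier G" for s s' U U'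
    using that by (auto simp: act_mult)
  have "piece_family (length Os) Ws Q"
  proof (rule piece_familyI)
    show "finite Q"
      unfolding Q_def using finP finP'
      by (intro finite_imageI finite_subset[OF _ finite_cartesian_product[OF finP finP']]) auto
      fix i V t l assume "(i, V, t, l) \<in> Q"
      then obtain U s k U' s' where p: "(i, U, s, k) \<in> P" "(k, U', s', l) \<in> P'"
        and eq: "V = U \<inter> \<phi> s -` U'" "t = s' \<otimes>\<^bsub>G\<^esub> s" unfolding Qiff by blast
      have "open (\<phi> s -` U')" using open_vimage[OF P'in(1)[OF p(2)] act_continuous[OF Pin(3)[OF p(1)]]] .
      moreover have "\<phi> t ` V \<subseteq> Ws ! l"
        using im[OF Pin(3)[OF p(1)] P'in(2)[OF p(2)]] P'in(4)[OF p(2)] unfolding eq by blast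
      ultimately show "i < length Os \<and> open V \<and> t \<in> carrier G \<and> l < length Ws \<and> \<phi> t ` V \<subseteq> Ws ! l"
        unfolding eq using Pin[OF p(1)] P'in[OF p(2)] by (auto intro: mult_in)
    next
      fix i1 V1 t1 i2 V2 t2 l assume q: "(i1, V1, t1, l) \<in> Q" "(i2, V2, t2, l) \<in> Q"
        and ne: "\<phi> t1 ` V1 \<inter> \<phi> t2 ` V2 \<noteq> {}"
      obtain U1 s1 k1 U1' s1' where p1: "(i1, U1, s1, k1) \<in> P" "(k1, U1', s1', l) \<in> P'"
        and eq1: "V1 = U1 \<inter> \<phi> s1 -` U1'" "t1 = s1' \<otimes>\<^bsub>G\<^esub> s1" using q unfolding Qiff by blast
      obtain U2 s2 k2 U2' s2' where p2: "(i2, U2, s2, k2) \<in> P" "(k2, U2', s2', l) \<in> P'"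
        and eq2: "V2 = U2 \<inter> \<phi> s2 -` U2'" "t2 = s2' \<otimes>\<^bsub>G\<^esub> s2" using q unfolding Qiff by blast
      have 1: "\<phi> t1 ` V1 \<subseteq> \<phi> s1' ` (\<phi> s1 ` U1 \<inter> U1')" unfolding eq1 using p1 Pin P'in by (intro im) blast+
      have 2: "\<phi> t2 ` V2 \<subseteq> \<phi> s2' ` (\<phi> s2 ` U2 \<inter> U2')" unfolding eq2 using p2 Pin P'in by (intro im) blast+
      obtain y where "y \<in> \<phi> t1 ` V1" "y \<in> \<phi> t2 ` V2" using ne by blast
      then have "y \<in> \<phi> s1' ` (\<phi> s1 ` U1 \<inter> U1')" "y \<in> \<phi> s2' ` (\<phi> s2 ` U2 \<inter> U2')" using 1 2 by blast+
      then obtain a b where ab: "a \<in> \<phi> s1 ` U1" "b \<in> \<phi> s2 ` U2" "y = \<phi> s1' a" "y = \<phi> s2' b" "a \<in> U1'" "b \<in> U2'"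
        by (elim imageE IntE) auto
      then have "\<phi> s1' ` U1' \<inter> \<phi> s2' ` U2' \<noteq> {}" by blast
      then have same: "k1 = k2" "U1' = U2'" "s1' = s2'"
        using piece_familyD(7)[OF P'(1) p1(2) p2(2)] by auto
      have "inj (\<phi> s1')" using act_bij P'in(2)[OF p1(2)] by (auto simp: bij_def)
      then have "a = b" using ab same by (metis injD)
      then have "\<phi> s1 ` U1 \<inter> \<phi> s2 ` U2 \<noteq> {}" using ab(1,2) by (simp only: disjoint_iff) blast
      moreover have "(i2, U2, s2, k1) \<in> P" using p2(1) same by simp
      ultimately have "i1 = i2 \<and> U1 = U2 \<and> s1 = s2"
        using piece_familyD(7)[OF P(1) p1(1)] by metis
      then show "i1 = i2 \<and> V1 = V2 \<and> t1 = t2" using same eq1 eq2 by simp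
  qed
  moreover have "F i \<subseteq> layer Q i" if "i < length Os" for i
  proof
    fix x assume "x \<in> F i"
    then obtain U s k where p: "(i, U, s, k) \<in> P" "x \<in> K (i, U, s, k)" using KF[OF \<open>i < length Os\<close>] by force
    have "\<phi> s x \<in> F' k" unfolding F'_def using p by force
    then obtain U' s' l where p': "(k, U', s', l) \<in> P'" "\<phi> s x \<in> U'"
      using P'(2)[of k] Pin(4)[OF p(1)] unfolding layer_def by blast
    have "(i, U \<inter> \<phi> s -` U', s' \<otimes>\<^bsub>G\<^esub> s, l) \<in> Q" using p p' unfolding Qiff by blast
    moreover have "x \<in> U \<inter> \<phi> s -` U'" using p p' K(2) by force
    ultimately show "x \<in> layer Q i" unfolding layer_def by blast
  qed
  ultimately show "\<exists>P. piece_family (length Os) Ws P \<and> (\<forall>i<length Os. F i \<subseteq> layer P i)" by blast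
qed

lemma dyn_subequiv_injection:
  assumes inj: "inj_on \<pi> {..<length As}"
    and sub: "\<And>i. i < length As \<Longrightarrow> open (As ! i) \<and> \<pi> i < length Bs \<and> As ! i \<subseteq> Bs ! \<pi> i"
  shows "dyn_subequiv G \<phi> As Bs"
proof (rule dyn_subequivI)
  let ?P = "(\<lambda>i. (i, As ! i, \<one>\<^bsub>G\<^esub>, \<pi> i)) ` {..<length As}"
  show "piece_family (length As) Bs ?P"
    by (rule piece_familyI) (use sub inj in \<open>auto simp: one_in act_one inj_on_def subset_eq\<close>)
  show "As ! i \<subseteq> layer ?P i" if "i < length As" for i using that unfolding layer_def by auto
qed

lemma dyn_subequiv_refl: "\<forall>A\<in>set As. open A \<Longrightarrow> dyn_subequiv G \<phi> As As"
  by (rule dyn_subequiv_injection[of id]) auto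

lemma dyn_subequiv_mset:
  assumes "mset As = mset Bs" "\<forall>A\<in>set As. open A"
  shows "dyn_subequiv G \<phi> As Bs"
proof -
  obtain p where p: "p permutes {..<length Bs}" "permute_list p Bs = As"
    using mset_eq_permutation[OF assms(1)] by blast
  have len: "length As = length Bs" using assms(1) by (metis size_mset)
  show ?thesis
  proof (rule dyn_subequiv_injection[of p])
    show "inj_on p {..<length As}" using p(1) by (meson permutes_inj_on)
    fix i assume i: "i < length As"
    then have "p i < length Bs" using p(1) len by (metis lessThan_iff permutes_in_image)
    moreover have "As ! i = Bs ! p i" using p i len by (metis permute_list_nth)
    moreover have "open (As ! i)" using assms(2) i by simp
    ultimately show "open (As ! i) \<and> p i < length Bs \<and> As ! i \<subseteq> Bs ! p i" by simp
  qed
qed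

lemma dyn_subequiv_append:
  assumes "dyn_subequiv G \<phi> As Bs" "dyn_subequiv G \<phi> As' Bs'"
  shows "dyn_subequiv G \<phi> (As @ As') (Bs @ Bs')"
  unfolding dyn_subequiv_iff_pieces
proof (intro allI impI)
  fix F assume F: "\<forall>i<length (As @ As'). closed (F i) \<and> F i \<subseteq> (As @ As') ! i"
  have "closed (F i) \<and> F i \<subseteq> As ! i" if "i < length As" for i
    using F[rule_format, of i] that by (auto simp: nth_append)
  then obtain P where P: "piece_family (length As) Bs P" "\<And>i. i < length As \<Longrightarrow> F i \<subseteq> layer P i"
    using assms(1) unfolding dyn_subequiv_iff_pieces by meson
  have "closed (F (i + length As)) \<and> F (i + length As) \<subseteq> As' ! i" if "i < length As'" for i
    using F[rule_format, of "i + length As"] that by (auto simp: nth_append)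
  then obtain P' where P': "piece_family (length As') Bs' P'" "\<And>i. i < length As' \<Longrightarrow> F (i + length As) \<subseteq> layer P' i"
    using assms(2)[unfolded dyn_subequiv_iff_pieces, rule_format, of "\<lambda>i. F (i + length As)"] by meson
  define shift where "shift = (\<lambda>(i, U :: 'x set, s :: 'g, k). (i + length As, U, s, k + length Bs))"
  have "piece_family (length (As @ As')) (Bs @ Bs') (P \<union> shift ` P')"
  proof (rule piece_familyI)
    show "finite (P \<union> shift ` P')" using piece_familyD(1)[OF P(1)] piece_familyD(1)[OF P'(1)] by simp
    have cases: "(i, U, s, k) \<in> P \<or> (\<exists>i' k'. (i', U, s, k') \<in> P' \<and> i = i' + length As \<and> k = k' + length Bs)"
      if "(i, U, s, k) \<in> P \<union> shift ` P'" for i U s k using that by (auto simp: shift_def)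
    show "i < length (As @ As') \<and> open U \<and> s \<in> carrier G \<and> k < length (Bs @ Bs') \<and> \<phi> s ` U \<subseteq> (Bs @ Bs') ! k"
      if "(i, U, s, k) \<in> P \<union> shift ` P'" for i U s k
      using cases[OF that]
    proof (elim disjE exE conjE)
      assume "(i, U, s, k) \<in> P"
      then show ?thesis using piece_familyD(2-6)[OF P(1)] by (simp add: nth_append trans_less_add1)
    next
      fix i' k' assume "(i', U, s, k') \<in> P'" "i = i' + length As" "k = k' + length Bs"
      then show ?thesis using piece_familyD(2-6)[OF P'(1)] by (simp add: nth_append)
    qed
    fix i U s i' U' s' k
    assume a: "(i, U, s, k) \<in> P \<union> shift ` P'" "(i', U', s', k) \<in> P \<union> shift ` P'" "\<phi> s ` U \<inter> \<phi> s' ` U' \<noteq> {}"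
    show "i = i' \<and> U = U' \<and> s = s'"
      using cases[OF a(1)] cases[OF a(2)] piece_familyD(5,7)[OF P(1)] piece_familyD(7)[OF P'(1)] a(3)
      by (metis add_right_cancel not_add_less2)
  qed
  moreover have "F i \<subseteq> layer (P \<union> shift ` P') i" if "i < length (As @ As')" for i
  proof (cases "i < length As")
    case True then show ?thesis using P(2) unfolding layer_def by blast
  next
    case False
    then have "F i \<subseteq> layer P' (i - length As)" using P'(2)[of "i - length As"] that by auto
    also have "\<dots> \<subseteq> layer (P \<union> shift ` P') i"
    proof -
      have "(i, U, s, k + length Bs) \<in> shift ` P'" if "(i - length As, U, s, k) \<in> P'" for U s k
        using that False unfolding shift_def by force
      then show ?thesis unfolding layer_def by blast
    qed
    finally show ?thesis .
  qed
  ultimately show "\<exists>P. piece_family (length (As @ As')) (Bs @ Bs') P \<and>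
      (\<forall>i<length (As @ As'). F i \<subseteq> layer P i)" by blast
qed

text \<open>
  Pieces with different tags never meet, so a single set is subequivalent to any list whose
  members contain translates of the sets of an open cover, even if that cover overlaps.
\<close>

lemma dyn_subequiv_cover:
  assumes "A \<subseteq> (\<Union>p<length Bs. U p)"
    and "\<And>p. p < length Bs \<Longrightarrow> open (U p) \<and> g p \<in> carrier G \<and> \<phi> (g p) ` U p \<subseteq> Bs ! p"
  shows "dyn_subequiv G \<phi> [A] Bs"
proof (rule dyn_subequivI)
  let ?P = "(\<lambda>p. (0, U p, g p, p)) ` {..<length Bs}"
  show "piece_family (length [A]) Bs ?P"
    unfolding piece_family_def using assms(2) by auto
  show "[A] ! i \<subseteq> layer ?P i" if "i < length [A]" for i
  proof
    fix x assume "x \<in> [A] ! i"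
    then obtain p where "p < length Bs" "x \<in> U p" "i = 0" using \<open>i < length [A]\<close> assms(1) by auto
    then show "x \<in> layer ?P i" unfolding layer_def by blast
  qed
qed

lemma dyn_subequiv_translate:
  "open A \<Longrightarrow> g \<in> carrier G \<Longrightarrow> dyn_subequiv G \<phi> [A] [\<phi> g ` A]"
  by (rule dyn_subequiv_cover[where U = "\<lambda>_. A" and g = "\<lambda>_. g"]) auto

lemma dyn_subequiv_Un: "open A \<Longrightarrow> open B \<Longrightarrow> dyn_subequiv G \<phi> [A \<union> B] [A, B]"
  by (rule dyn_subequiv_cover[where U = "\<lambda>p. [A, B] ! p" and g = "\<lambda>_. \<one>\<^bsub>G\<^esub>"])
    (auto simp: one_in act_one less_Suc_eq lessThan_Suc)

lemma dyn_subequiv_disjoint: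
  assumes "open A" "open B" "A \<inter> B = {}"
  shows "dyn_subequiv G \<phi> [A, B] [A \<union> B]"
proof (rule dyn_subequivI)
  let ?P = "{(0, A, \<one>\<^bsub>G\<^esub>, 0), (1, B, \<one>\<^bsub>G\<^esub>, 0)} :: (nat \<times> 'x set \<times> 'g \<times> nat) set"
  show "piece_family (length [A, B]) [A \<union> B] ?P"
    unfolding piece_family_def using assms by (auto simp: one_in act_one)
  show "[A, B] ! i \<subseteq> layer ?P i" if "i < length [A, B]" for i
    using that unfolding layer_def by (auto simp: less_Suc_eq)
qed

lemma dyn_subequiv_Nil: "dyn_subequiv G \<phi> [] Bs"
  by (rule dyn_subequiv_injection[of id]) auto

lemma dyn_subequiv_saturation:
  assumes "dyn_subequiv G \<phi> As Bs"
  shows "\<Union>(set As) \<subseteq> saturation G \<phi> (\<Union>(set Bs))"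
proof
  fix x assume "x \<in> \<Union>(set As)"
  then obtain i where i: "i < length As" "x \<in> As ! i" by (auto simp: in_set_conv_nth)
  define F where "F j = (if j = i then {x} else {})" for j
  have "\<forall>j<length As. closed (F j) \<and> F j \<subseteq> As ! j" using i by (auto simp: F_def)
  then obtain P where P: "piece_family (length As) Bs P" and FP: "\<forall>j<length As. F j \<subseteq> layer P j"
    using assms unfolding dyn_subequiv_iff_pieces by meson
  obtain U s k where p: "(i, U, s, k) \<in> P" "x \<in> U"
  proof -
    have "x \<in> layer P i" using FP i(1) by (auto simp: F_def)
    then show ?thesis using that unfolding layer_def by blast
  qed
  have s: "inv\<^bsub>G\<^esub> s \<in> carrier G" and "\<phi> s x \<in> Bs ! k" and "Bs ! k \<in> set Bs"
    using piece_familyD(4-6)[OF P p(1)] p(2) by (auto intro: inv_in)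
  moreover have "x = \<phi> (inv\<^bsub>G\<^esub> s) (\<phi> s x)" using act_inv piece_familyD(4)[OF P p(1)] by simp
  ultimately show "x \<in> saturation G \<phi> (\<Union>(set Bs))" unfolding saturation_def by blast
qed

lemma dyn_subequiv_member: "B \<in> set Bs \<Longrightarrow> open B \<Longrightarrow> dyn_subequiv G \<phi> [B] Bs"
  unfolding in_set_conv_nth by (elim exE conjE) (rule dyn_subequiv_injection[of "\<lambda>_. i" for i]; auto simp: inj_on_def)

lemma dyn_subequiv_replicate:
  "set Cs \<subseteq> set Bs \<Longrightarrow> \<forall>B\<in>set Bs. open B \<Longrightarrow> dyn_subequiv G \<phi> Cs (concat (replicate (length Cs) Bs))"
proof (induction Cs)
  case (Cons C Cs)
  then show ?case using dyn_subequiv_append[OF dyn_subequiv_member[of C Bs], of Cs] by simp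
qed (simp add: dyn_subequiv_Nil)

text \<open>
  The relation tests only closed subsets of the source, and an open set with closure in the source
  fits around each of them.
\<close>

lemma dyn_subequiv_approx:
  assumes op: "\<forall>A\<in>set As. open A"
    and approx: "\<And>As'. length As' = length As \<Longrightarrow>
      (\<And>i. i < length As \<Longrightarrow> open (As' ! i) \<and> closure (As' ! i) \<subseteq> As ! i) \<Longrightarrow> dyn_subequiv G \<phi> As' Bs"
  shows "dyn_subequiv G \<phi> As Bs"
  unfolding dyn_subequiv_iff_pieces
proof (intro allI impI)
  fix F assume F: "\<forall>i<length As. closed (F i) \<and> F i \<subseteq> As ! i"
  have "\<exists>W. open W \<and> F i \<subseteq> W \<and> closure W \<subseteq> As ! i" if "i < length As" for i
    using F op that by (metis nth_mem open_set_between)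
  then obtain W where W: "\<And>i. i < length As \<Longrightarrow> open (W i) \<and> F i \<subseteq> W i \<and> closure (W i) \<subseteq> As ! i" by metis
  let ?As' = "map W [0..<length As]"
  have "dyn_subequiv G \<phi> ?As' Bs" by (rule approx) (use W in auto)
  moreover have "\<forall>i<length ?As'. closed (F i) \<and> F i \<subseteq> ?As' ! i" using F W by auto
  ultimately show "\<exists>P. piece_family (length As) Bs P \<and> (\<forall>i<length As. F i \<subseteq> layer P i)"
    unfolding dyn_subequiv_iff_pieces by (metis (no_types, lifting) length_map length_upt diff_zero)
qed

end

section \<open>Premeasures are monotone under dynamical subequivalence\<close>

context compact_action
begin

text \<open>
  For closed sets inside the source, invariance moves each piece into the target, where the pieces
  are disjoint; so the total measure of the closed sets is at most that of the target.  Open sets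
  are increasing unions of closed ones, and continuity from below passes to the limit.
\<close>

lemma premeasure_le_of_dyn_subequiv:
  assumes \<mu>: "\<mu> \<in> invariant_premeasures G \<phi>" and sub: "dyn_subequiv G \<phi> As Bs"
    and opA: "\<forall>A\<in>set As. open A" and opB: "\<forall>B\<in>set Bs. open B"
  shows "(\<Sum>A\<leftarrow>As. \<mu> A) \<le> (\<Sum>B\<leftarrow>Bs. \<mu> B)"
proof -
  interpret algebra UNIV "open_algebra :: 'x set set" by (rule algebra_open_algebra)
  have pos: "positive open_algebra \<mu>" and ca: "countably_additive open_algebra \<mu>"
    and inv: "\<And>g B. g \<in> carrier G \<Longrightarrow> B \<in> open_algebra \<Longrightarrow> \<mu> (\<phi> g ` B) = \<mu> B"
    using \<mu> unfolding invariant_premeasures_def by auto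
  note add = countably_additive_additive[OF pos ca]
  note inc = increasingD[OF additive_increasing[OF pos add]]
  let ?n = "length As" and ?m = "length Bs"
  have bound: "(\<Sum>i<?n. \<mu> (F i)) \<le> (\<Sum>l<?m. \<mu> (Bs ! l))"
    if F: "\<forall>i<?n. closed (F i) \<and> F i \<subseteq> As ! i" for F
  proof -
    obtain P where P: "piece_family ?n Bs P" and FP: "\<And>i. i < ?n \<Longrightarrow> F i \<subseteq> layer P i"
      using sub F unfolding dyn_subequiv_iff_pieces by meson
    note fin = piece_familyD(1)[OF P]
    define U where "U p = fst (snd p)" for p :: "nat \<times> 'x set \<times> 'g \<times> nat"
    define V where "V p = \<phi> (fst (snd (snd p))) ` fst (snd p)" for p :: "nat \<times> 'x set \<times> 'g \<times> nat"
    define k where "k p = snd (snd (snd p))" for p :: "nat \<times> 'x set \<times> 'g \<times> nat"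
    have mem: "(fst p, U p, fst (snd (snd p)), k p) \<in> P" if "p \<in> P" for p
      using that by (simp add: U_def k_def)
    have U: "open (U p)" and s: "fst (snd (snd p)) \<in> carrier G" and Vk: "V p \<subseteq> Bs ! k p"
      and k: "k p < ?m" and fst: "fst p < ?n" if "p \<in> P" for p
      using piece_familyD(2-6)[OF P mem[OF that]] by (simp_all add: V_def U_def)
    have V: "open (V p)" "\<mu> (V p) = \<mu> (U p)" if "p \<in> P" for p
      using act_open[OF s[OF that] U[OF that]] inv[OF s[OF that] open_in_open_algebra[OF U[OF that]]]
      by (simp_all add: V_def U_def)
    have "(\<Sum>i<?n. \<mu> (F i)) \<le> (\<Sum>i<?n. \<Sum>p\<in>{p\<in>P. fst p = i}. \<mu> (V p))"
    proof (rule sum_mono)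
      fix i assume i: "i \<in> {..<?n}"
      have op: "U ` {p\<in>P. fst p = i} \<subseteq> open_algebra" using U by (auto intro: open_in_open_algebra)
      have "F i \<subseteq> (\<Union>p\<in>{p\<in>P. fst p = i}. U p)" using FP[of i] i unfolding layer_def U_def by force
      then have "\<mu> (F i) \<le> \<mu> (\<Union>p\<in>{p\<in>P. fst p = i}. U p)"
        by (intro inc closed_in_open_algebra open_in_open_algebra open_UN) (use F i U in auto)
      also have "\<dots> \<le> (\<Sum>p\<in>{p\<in>P. fst p = i}. \<mu> (U p))" using fin by (intro subadditive[OF pos add op]) auto
      also have "\<dots> = (\<Sum>p\<in>{p\<in>P. fst p = i}. \<mu> (V p))" using V(2) by (intro sum.cong) auto
      finally show "\<mu> (F i) \<le> (\<Sum>p\<in>{p\<in>P. fst p = i}. \<mu> (V p))" .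
    qed
    also have "\<dots> = (\<Sum>p\<in>P. \<mu> (V p))" using fin fst by (intro sum.group) auto
    also have "\<dots> = (\<Sum>l<?m. \<Sum>p\<in>{p\<in>P. k p = l}. \<mu> (V p))" using fin k by (intro sum.group[symmetric]) auto
    also have "\<dots> \<le> (\<Sum>l<?m. \<mu> (Bs ! l))"
    proof (rule sum_mono)
      fix l assume l: "l \<in> {..<?m}"
      have "disjoint_family_on V {p\<in>P. k p = l}"
        unfolding disjoint_family_on_def
      proof (intro ballI impI, rule ccontr)
        fix p q assume p: "p \<in> {p\<in>P. k p = l}" "q \<in> {p\<in>P. k p = l}" "p \<noteq> q" "V p \<inter> V q \<noteq> {}"
        obtain i W s i' W' s' where "p = (i, W, s, l)" "q = (i', W', s', l)"
          using p by (cases p; cases q) (auto simp: k_def)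
        then show False using p piece_familyD(7)[OF P] unfolding V_def by (metis (no_types, lifting) fst_conv mem_Collect_eq snd_conv)
      qed
      then have "(\<Sum>p\<in>{p\<in>P. k p = l}. \<mu> (V p)) = \<mu> (\<Union>p\<in>{p\<in>P. k p = l}. V p)"
        using fin V(1) by (intro additive_sum[OF pos add]) (auto intro!: open_in_open_algebra)
      also have "\<dots> \<le> \<mu> (Bs ! l)"
      proof (intro inc open_in_open_algebra open_UN)
        show "(\<Union>p\<in>{p\<in>P. k p = l}. V p) \<subseteq> Bs ! l" using Vk by blast
      qed (use V l opB in auto)
      finally show "(\<Sum>p\<in>{p\<in>P. k p = l}. \<mu> (V p)) \<le> \<mu> (Bs ! l)" .
    qed
    finally show ?thesis .
  qed
  have "\<exists>K. (\<forall>n. closed (K n)) \<and> incseq K \<and> (\<Union>n. K n) = As ! i" if "i < ?n" for i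
    using open_algebra_incseq_closed[OF open_in_open_algebra, of "As ! i"] opA that by (metis nth_mem)
  then obtain K where K: "\<And>i. i < ?n \<Longrightarrow> (\<forall>n. closed (K i n)) \<and> incseq (K i) \<and> (\<Union>n. K i n) = As ! i" by metis
  have lim: "(\<lambda>n. \<mu> (K i n)) \<longlonglongrightarrow> \<mu> (As ! i)" if "i < ?n" for i
  proof -
    have "range (K i) \<subseteq> open_algebra" "(\<Union>n. K i n) \<in> open_algebra"
      using K[OF that] opA that by (auto simp: open_in_open_algebra intro: closed_in_open_algebra)
    then show ?thesis
      using countably_additive_iff_continuous_from_below[OF pos add, THEN iffD1, OF ca, rule_format, of "K i"]
        K[OF that] by simp
  qed
  have "(\<lambda>n. \<Sum>i<?n. \<mu> (K i n)) \<longlonglongrightarrow> (\<Sum>i<?n. \<mu> (As ! i))" using lim by (intro tendsto_sum) auto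
  moreover have "(\<Sum>i<?n. \<mu> (K i n)) \<le> (\<Sum>l<?m. \<mu> (Bs ! l))" for n
    by (rule bound) (use K in blast)
  ultimately have "(\<Sum>i<?n. \<mu> (As ! i)) \<le> (\<Sum>l<?m. \<mu> (Bs ! l))" by (intro LIMSEQ_le_const2) auto
  then show ?thesis by (simp add: sum_list_sum_nth atLeast0LessThan)
qed

lemma sum_list_concat_replicate:
  "(\<Sum>A\<leftarrow>concat (replicate n As). \<mu> A) = of_nat n * (\<Sum>A\<leftarrow>As. \<mu> A :: ennreal)"
  by (induction n) (auto simp: algebra_simps)

lemma premeasure_less_of_multiples:
  assumes \<mu>: "\<mu> \<in> invariant_premeasures G \<phi>" and op: "\<forall>A\<in>set As. open A" "\<forall>B\<in>set Bs. open B"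
    and sub: "dyn_subequiv G \<phi> (concat (replicate (Suc n) As)) (concat (replicate n Bs))"
    and B1: "(\<Sum>B\<leftarrow>Bs. \<mu> B) = 1"
  shows "(\<Sum>A\<leftarrow>As. \<mu> A) < 1"
proof (rule ccontr)
  assume "\<not> ?thesis"
  then have "of_nat (Suc n) * 1 \<le> of_nat (Suc n) * (\<Sum>A\<leftarrow>As. \<mu> A)" by (intro mult_left_mono) auto
  also have "\<dots> \<le> of_nat n * (\<Sum>B\<leftarrow>Bs. \<mu> B)"
  proof -
    have "\<forall>A\<in>set (concat (replicate m Cs)). open A" if "\<forall>A\<in>set Cs. open A" for m and Cs :: "'x set list"
      using that by auto
    from premeasure_le_of_dyn_subequiv[OF \<mu> sub this[OF op(1)] this[OF op(2)]] show ?thesis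
      by (simp only: sum_list_concat_replicate)
  qed
  finally have "(of_nat (Suc n) :: ennreal) \<le> of_nat n" using B1 by simp
  then show False by (simp only: of_nat_le_iff)
qed

end

section \<open>States on open sets and strict comparison\<close>

lemma mset_concat_replicate: "mset (concat (replicate n xs)) = repeat_mset n (mset xs)"
  by (induction n) auto

lemma sum_list_ennreal_nonneg:
  "(\<And>a. 0 \<le> f a) \<Longrightarrow> (\<Sum>a\<leftarrow>xs. ennreal (f a)) = ennreal (\<Sum>a\<leftarrow>xs. f a)"
proof (induction xs)
  case (Cons a xs)
  have "0 \<le> (\<Sum>a\<leftarrow>xs. f a)" using Cons.prems by (intro sum_list_nonneg) auto
  then show ?case using Cons by (simp add: ennreal_plus)
qed simp

text \<open>
  Monotonicity on lists rather than on single sets contains additivity properties: it makes \<open>D\<close>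
  subadditive on unions and superadditive on disjoint unions.
\<close>

definition (in compact_action) dyn_state :: "('x set \<Rightarrow> ennreal) \<Rightarrow> bool" where
  "dyn_state D \<longleftrightarrow> (\<forall>Cs Ds. (\<forall>C\<in>set Cs. open C) \<longrightarrow> (\<forall>C\<in>set Ds. open C) \<longrightarrow> dyn_subequiv G \<phi> Cs Ds \<longrightarrow>
      (\<Sum>C\<leftarrow>Cs. D C) \<le> (\<Sum>C\<leftarrow>Ds. D C))"

text \<open>
  States exist on the order ideal \<open>T\<close> of open sets bounded by a multiple of \<open>Bs\<close>, where \<open>Bs\<close> is an
  order unit.  The preorder on multisets ignores members outside \<open>T\<close>, so that it is defined for
  all multisets of sets and \<open>Bs\<close> bounds each of them up to a multiple.  Extending the state by infinity outside
  the ideal preserves monotonicity, because everything below a list in \<open>T\<close> lies in \<open>T\<close>.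
\<close>

lemma (in compact_action) exists_dyn_state:
  assumes opA: "\<forall>A\<in>set As. open A" and opB: "\<forall>B\<in>set Bs. open B"
    and unit: "\<And>A. A \<in> set As \<Longrightarrow> \<exists>n. dyn_subequiv G \<phi> [A] (concat (replicate n Bs))"
    and noperf: "\<And>m. m > 0 \<Longrightarrow>
      \<not> dyn_subequiv G \<phi> (concat (replicate (Suc m) As)) (concat (replicate m Bs))"
  obtains D where "dyn_state D" "(\<Sum>B\<leftarrow>Bs. D B) = 1" "(\<Sum>A\<leftarrow>As. D A) \<ge> 1"
proof -
  define T where "T = {A. open A \<and> (\<exists>n. dyn_subequiv G \<phi> [A] (concat (replicate n Bs)))}"
  define le where "le M N \<longleftrightarrow> (\<exists>Cs Ds. mset Cs = filter_mset (\<lambda>A. A \<in> T) M \<and>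
      mset Ds = filter_mset (\<lambda>A. A \<in> T) N \<and> dyn_subequiv G \<phi> Cs Ds)" for M N
  have AT: "set As \<subseteq> T" using opA unit by (auto simp: T_def)
  have BT: "set Bs \<subseteq> T"
  proof
    fix B assume "B \<in> set Bs"
    then have "open B" "dyn_subequiv G \<phi> [B] (concat (replicate 1 Bs))"
      using dyn_subequiv_member opB by auto
    then show "B \<in> T" unfolding T_def by blast
  qed
  have inT: "set Cs \<subseteq> T" if "mset Cs = filter_mset (\<lambda>A. A \<in> T) M" for Cs M
    using arg_cong[OF that, of set_mset] by auto
  have opT: "open C" if "C \<in> T" for C using that by (simp add: T_def)
  have same: "dyn_subequiv G \<phi> Cs Ds" if "mset Cs = mset Ds" "set Cs \<subseteq> T" for Cs Ds
    using dyn_subequiv_mset[OF that(1)] that(2) opT by blast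
  have filT: "filter_mset (\<lambda>A. A \<in> T) (mset Cs) = mset Cs" if "set Cs \<subseteq> T" for Cs
    using that by (auto simp: filter_mset_eq_conv)
  have leI: "le (mset Cs) (mset Ds)" if "set Cs \<subseteq> T" "set Ds \<subseteq> T" "dyn_subequiv G \<phi> Cs Ds" for Cs Ds
    unfolding le_def using that filT by metis
  have leD: "dyn_subequiv G \<phi> Cs Ds" if "le (mset Cs) (mset Ds)" "set Cs \<subseteq> T" "set Ds \<subseteq> T" for Cs Ds
  proof -
    note CD = that
    obtain Cs' Ds' where "mset Cs' = mset Cs" "mset Ds' = mset Ds" "dyn_subequiv G \<phi> Cs' Ds'"
      using CD(1) unfolding le_def filT[OF CD(2)] filT[OF CD(3)] by blast
    then show ?thesis using same that(2,3) dyn_subequiv_trans by (metis set_mset_mset)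
  qed
  have refl: "le M M" for M
  proof -
    obtain Cs where Cs: "mset Cs = filter_mset (\<lambda>A. A \<in> T) M" using ex_mset by blast
    then show ?thesis unfolding le_def using same[OF HOL.refl inT[OF Cs]] by blast
  qed
  obtain d :: "'x set \<Rightarrow> real" where d: "\<And>a. 0 \<le> d a"
    "\<And>M N. le M N \<Longrightarrow> (\<Sum>a\<in>#M. d a) \<le> (\<Sum>a\<in>#N. d a)"
    "(\<Sum>a\<in>#mset Bs. d a) = 1" "(\<Sum>a\<in>#mset As. d a) \<ge> 1"
  proof (rule exists_normalized_state[of le "mset Bs" "mset As"])
    show "le M M" for M by (rule refl)
    show "le M P" if "le M N" "le N P" for M N P
    proof -
      obtain Cs Ds where 1: "mset Cs = filter_mset (\<lambda>A. A \<in> T) M" "mset Ds = filter_mset (\<lambda>A. A \<in> T) N"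
        "dyn_subequiv G \<phi> Cs Ds" using \<open>le M N\<close> unfolding le_def by blast
      obtain Ds' Es where 2: "mset Ds' = filter_mset (\<lambda>A. A \<in> T) N" "mset Es = filter_mset (\<lambda>A. A \<in> T) P"
        "dyn_subequiv G \<phi> Ds' Es" using \<open>le N P\<close> unfolding le_def by blast
      have "dyn_subequiv G \<phi> Ds Ds'" using 1(2) 2(1) inT[OF 1(2)] by (intro same) auto
      then have "dyn_subequiv G \<phi> Cs Es" using 1(3) 2(3) dyn_subequiv_trans by blast
      then show ?thesis unfolding le_def using 1(1) 2(2) by blast
    qed
    show "le (M + P) (N + P)" if "le M N" for M N P
    proof -
      obtain Cs Ds where 1: "mset Cs = filter_mset (\<lambda>A. A \<in> T) M" "mset Ds = filter_mset (\<lambda>A. A \<in> T) N"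
        "dyn_subequiv G \<phi> Cs Ds" using \<open>le M N\<close> unfolding le_def by blast
      obtain Es where 2: "mset Es = filter_mset (\<lambda>A. A \<in> T) P" using ex_mset by blast
      have "dyn_subequiv G \<phi> (Cs @ Es) (Ds @ Es)"
        using 1(3) same[OF HOL.refl inT[OF 2]] by (rule dyn_subequiv_append)
      moreover have "mset (Cs @ Es) = filter_mset (\<lambda>A. A \<in> T) (M + P)"
        "mset (Ds @ Es) = filter_mset (\<lambda>A. A \<in> T) (N + P)" using 1 2 by simp_all
      ultimately show ?thesis unfolding le_def by blast
    qed
    show "le {#} M" for M
    proof -
      obtain Es where "mset Es = filter_mset (\<lambda>A. A \<in> T) M" using ex_mset by blast
      moreover have "mset [] = filter_mset (\<lambda>A. A \<in> T) {#}" by simp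
      ultimately show ?thesis unfolding le_def using dyn_subequiv_Nil by blast
    qed
    note le_empty = this
    show "\<exists>n. le {#A#} (repeat_mset n (mset Bs))" for A
    proof (cases "A \<in> T")
      case True
      then obtain n where n: "dyn_subequiv G \<phi> [A] (concat (replicate n Bs))" by (auto simp: T_def)
      have "le (mset [A]) (mset (concat (replicate n Bs)))" by (rule leI) (use True BT n in auto)
      then show ?thesis by (auto simp: mset_concat_replicate)
    next
      case False
      then have "le {#A#} (repeat_mset 0 (mset Bs)) = le {#} {#}" unfolding le_def by simp
      then show ?thesis using refl by blast
    qed
    show "\<not> le (repeat_mset (Suc m) (mset As)) (repeat_mset m (mset Bs))" if "m > 0" for m
    proof
      assume "le (repeat_mset (Suc m) (mset As)) (repeat_mset m (mset Bs))"
      then have "le (mset (concat (replicate (Suc m) As))) (mset (concat (replicate m Bs)))"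
        by (simp only: mset_concat_replicate)
      then have "dyn_subequiv G \<phi> (concat (replicate (Suc m) As)) (concat (replicate m Bs))"
        by (rule leD) (use AT BT in auto)
      then show False using noperf[OF that] by blast
    qed
  qed (rule that)
  define D where "D A = (if A \<in> T then ennreal (d A) else \<infinity>)" for A
  have sumD: "(\<Sum>C\<leftarrow>Cs. D C) = ennreal (\<Sum>a\<in>#mset Cs. d a)" if "set Cs \<subseteq> T" for Cs
  proof -
    have "(\<Sum>C\<leftarrow>Cs. D C) = (\<Sum>C\<leftarrow>Cs. ennreal (d C))"
      using that by (intro arg_cong[of _ _ sum_list] map_cong) (auto simp: D_def)
    also have "\<dots> = ennreal (\<Sum>C\<leftarrow>Cs. d C)" using d(1) by (rule sum_list_ennreal_nonneg)
    also have "(\<Sum>C\<leftarrow>Cs. d C) = (\<Sum>a\<in>#mset Cs. d a)" by (metis mset_map sum_mset_sum_list)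
    finally show ?thesis .
  qed
  show ?thesis
  proof (rule that)
    show "(\<Sum>B\<leftarrow>Bs. D B) = 1" using sumD[OF BT] d(3) by simp
    show "1 \<le> (\<Sum>A\<leftarrow>As. D A)" using sumD[OF AT] d(4) by simp
    show "dyn_state D"
      unfolding dyn_state_def
    proof (intro allI impI)
      fix Cs Ds :: "'x set list"
      assume opC: "\<forall>C\<in>set Cs. open C" and opD: "\<forall>C\<in>set Ds. open C" and CD: "dyn_subequiv G \<phi> Cs Ds"
      show "(\<Sum>C\<leftarrow>Cs. D C) \<le> (\<Sum>C\<leftarrow>Ds. D C)"
      proof (cases "set Ds \<subseteq> T")
        case True
        have "\<exists>n. dyn_subequiv G \<phi> Ds (concat (replicate n Bs))" using True
        proof (induction Ds)
          case Nil show ?case using dyn_subequiv_Nil by blast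
        next
          case (Cons E Ds)
          then obtain n m where "dyn_subequiv G \<phi> [E] (concat (replicate n Bs))" "dyn_subequiv G \<phi> Ds (concat (replicate m Bs))"
            unfolding T_def by auto
          then have "dyn_subequiv G \<phi> ([E] @ Ds) (concat (replicate (n + m) Bs))"
            unfolding replicate_add concat_append by (rule dyn_subequiv_append)
          then show ?case by auto
        qed
        then obtain n where n: "dyn_subequiv G \<phi> Ds (concat (replicate n Bs))" by blast
        have CT: "set Cs \<subseteq> T"
        proof
          fix C assume C: "C \<in> set Cs"
          then have "dyn_subequiv G \<phi> [C] Cs" using dyn_subequiv_member opC by blast
          then show "C \<in> T" unfolding T_def using C opC CD n dyn_subequiv_trans by blast
        qed
        show ?thesis using leI[OF CT True CD] d(2) by (simp add: sumD CT True ennreal_leI)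
      next
        case False
        then obtain E where "E \<in> set Ds" "E \<notin> T" by blast
        then have "(\<Sum>C\<leftarrow>Ds. D C) = \<infinity>" by (induction Ds) (auto simp: D_def)
        then show ?thesis by simp
      qed
    qed
  qed
qed

text \<open>
  The measure condition implies \<open>(m + 1) As' \<prec> m Bs\<close> for some \<open>m \<ge> 1\<close> whenever \<open>As'\<close> is
  compactly contained in \<open>As\<close>.  Otherwise there is a state with \<open>D(Bs) = 1 \<le> D(As')\<close>, and its
  regularization contradicts the condition.  If the regularization vanishes on \<open>Bs\<close>, it
  also vanishes on the saturation, by countability of the group.
\<close>

lemma (in compact_action) strict_comparison_multiples:
  assumes count: "countable (carrier G)"
    and opA: "\<forall>A\<in>set As. open A" and opB: "\<forall>B\<in>set Bs. open B"
    and sat: "\<Union>(set As) \<subseteq> saturation G \<phi> (\<Union>(set Bs))"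
    and less: "\<And>\<mu>. \<mu> \<in> invariant_premeasures G \<phi> \<Longrightarrow> (\<Sum>B\<leftarrow>Bs. \<mu> B) = 1 \<Longrightarrow> (\<Sum>A\<leftarrow>As. \<mu> A) < (\<Sum>B\<leftarrow>Bs. \<mu> B)"
    and len: "length As' = length As"
    and below: "\<And>i. i < length As \<Longrightarrow> open (As' ! i) \<and> closure (As' ! i) \<subseteq> As ! i"
  shows "\<exists>m>0. dyn_subequiv G \<phi> (concat (replicate (Suc m) As')) (concat (replicate m Bs))"
proof (rule ccontr)
  assume neg: "\<not> ?thesis"
  have opA': "\<forall>A\<in>set As'. open A" using below len by (metis in_set_conv_nth)
  have unit: "\<exists>n. dyn_subequiv G \<phi> [A] (concat (replicate n Bs))" if "A \<in> set As'" for A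
  proof -
    obtain i where i: "i < length As" "A = As' ! i" using \<open>A \<in> set As'\<close> len by (metis in_set_conv_nth)
    let ?T = "\<lambda>q. \<phi> (fst q) ` snd q"
    have c1: "compact (closure A)" using compact_space by (metis closed_closure compact_Int_closed inf_top_left)
    have c2: "closure A \<subseteq> (\<Union>q\<in>carrier G \<times> set Bs. ?T q)"
      using below[OF i(1)] i nth_mem[OF i(1)] sat unfolding saturation_def by fastforce
    have c3: "\<And>q. q \<in> carrier G \<times> set Bs \<Longrightarrow> open (?T q)" using opB by (auto intro: act_open)
    obtain Q where Q: "Q \<subseteq> carrier G \<times> set Bs" "finite Q" "closure A \<subseteq> (\<Union>q\<in>Q. ?T q)"
      by (rule compactE_image[OF c1 c3 c2])
    obtain qs where qs: "set qs = Q" using finite_list[OF Q(2)] by blast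
    have "dyn_subequiv G \<phi> [A] (map snd qs)"
    proof (rule dyn_subequiv_cover[where U = "\<lambda>p. ?T (qs ! p)" and g = "\<lambda>p. inv\<^bsub>G\<^esub> (fst (qs ! p))"])
      show "A \<subseteq> (\<Union>p<length (map snd qs). ?T (qs ! p))"
      proof
        fix x assume "x \<in> A"
        then have "x \<in> closure A" using closure_subset by blast
        then obtain q where "q \<in> Q" "x \<in> ?T q" using Q(3) by blast
        then obtain p where "p < length qs" "x \<in> ?T (qs ! p)" using qs by (metis in_set_conv_nth)
        then show "x \<in> (\<Union>p<length (map snd qs). ?T (qs ! p))" by auto
      qed
      fix p assume "p < length (map snd qs)"
      then have p: "p < length qs" "qs ! p \<in> Q" using qs by auto
      then have "fst (qs ! p) \<in> carrier G" "open (snd (qs ! p))" using Q(1) opB by auto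
      then show "open (?T (qs ! p)) \<and> inv\<^bsub>G\<^esub> (fst (qs ! p)) \<in> carrier G \<and>
          \<phi> (inv\<^bsub>G\<^esub> (fst (qs ! p))) ` ?T (qs ! p) \<subseteq> map snd qs ! p"
        using p by (auto simp: act_inv intro!: act_open inv_in)
    qed
    moreover have "dyn_subequiv G \<phi> (map snd qs) (concat (replicate (length (map snd qs)) Bs))"
      using Q(1) qs opB by (intro dyn_subequiv_replicate) auto
    ultimately show ?thesis using dyn_subequiv_trans by blast
  qed
  have noperf: "\<not> dyn_subequiv G \<phi> (concat (replicate (Suc m) As')) (concat (replicate m Bs))" if "m > 0" for m
    using neg that by blast
  obtain D where D: "dyn_state D" and DB: "(\<Sum>B\<leftarrow>Bs. D B) = 1" and DA: "(\<Sum>A\<leftarrow>As'. D A) \<ge> 1"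
    by (rule exists_dyn_state[OF opA' opB unit noperf])
  have Dmono: "(\<Sum>C\<leftarrow>Cs. D C) \<le> (\<Sum>C\<leftarrow>Ds. D C)"
    if "\<forall>C\<in>set Cs. open C" "\<forall>C\<in>set Ds. open C" "dyn_subequiv G \<phi> Cs Ds" for Cs Ds
    using D that unfolding dyn_state_def by blast
  have D_single: "D A \<le> D B" if "open A" "open B" "dyn_subequiv G \<phi> [A] [B]" for A B
    using Dmono[of "[A]" "[B]"] that by simp
  interpret open_content D
  proof
    show "compact (UNIV :: 'x set)" by (rule compact_space)
    have "dyn_subequiv G \<phi> [{}] []" by (rule dyn_subequiv_cover[where U = "\<lambda>_. {}"]) auto
    then show "D {} = 0" using Dmono[of "[{}]" "[]"] by simp
    show "D A \<le> D B" if "open A" "open B" "A \<subseteq> B" for A B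
      using D_single[OF that(1,2)] dyn_subequiv_injection[of id "[A]" "[B]"] that by simp
    show "D (A \<union> B) \<le> D A + D B" if "open A" "open B" for A B
      using Dmono[OF _ _ dyn_subequiv_Un[OF that]] that by (simp add: open_Un)
    show "D A + D B \<le> D (A \<union> B)" if "open A" "open B" "A \<inter> B = {}" for A B
      using Dmono[OF _ _ dyn_subequiv_disjoint[OF that]] that by (simp add: open_Un)
  qed
  have D_inv: "D (\<phi> g ` W) = D W" if g: "g \<in> carrier G" and W: "open W" for g W
  proof (rule antisym)
    show "D W \<le> D (\<phi> g ` W)" using dyn_subequiv_translate[OF W g] W g by (intro D_single act_open)
    have "\<phi> (inv\<^bsub>G\<^esub> g) ` \<phi> g ` W = W" using g by (simp add: image_image act_inv)
    then have "dyn_subequiv G \<phi> [\<phi> g ` W] [W]"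
      using dyn_subequiv_translate[OF act_open[OF g W] inv_in[OF g]] by simp
    then show "D (\<phi> g ` W) \<le> D W" using W g by (intro D_single act_open)
  qed
  have inv_fun: "\<exists>k. continuous_on UNIV k \<and> (\<forall>x. k (\<phi> g x) = x) \<and> (\<forall>x. \<phi> g (k x) = x)" if "g \<in> carrier G" for g
    using that by (intro exI[of _ "\<phi> (inv\<^bsub>G\<^esub> g)"]) (auto simp: act_inv intro!: act_continuous inv_in)
  let ?\<mu> = outer_content
  have \<mu>A: "1 \<le> (\<Sum>A\<leftarrow>As. ?\<mu> A)"
  proof -
    have "D (As' ! i) \<le> ?\<mu> (As ! i)" if "i < length As" for i
      using inner_upper[of "As' ! i" "As ! i"] below[OF that] opA that by (simp add: outer_open)
    then have "(\<Sum>A\<leftarrow>As'. D A) \<le> (\<Sum>A\<leftarrow>As. ?\<mu> A)"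
      by (auto simp: sum_list_sum_nth len intro!: sum_mono)
    then show ?thesis using DA by simp
  qed
  define s where "s = (\<Sum>B\<leftarrow>Bs. ?\<mu> B)"
  have "s \<le> (\<Sum>B\<leftarrow>Bs. D B)"
    unfolding s_def using opB by (intro sum_list_mono) (simp add: outer_open inner_le)
  then have s1: "s \<le> 1" using DB by simp
  show False
  proof (cases "s = 0")
    case True
    have "?\<mu> (\<Union>(set Bs)) \<le> s" unfolding s_def
    proof (induction Bs)
      case (Cons B Bs)
      have "?\<mu> (\<Union>(set (B # Bs))) \<le> ?\<mu> B + ?\<mu> (\<Union>(set Bs))" using outer_Un by simp
      also have "\<dots> \<le> ?\<mu> B + (\<Sum>B\<leftarrow>Bs. ?\<mu> B)" by (intro add_left_mono Cons)
      finally show ?case by simp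
    qed (simp add: outer_empty)
    then have B0: "?\<mu> (\<Union>(set Bs)) = 0" using True by simp
    have range: "range (from_nat_into (carrier G)) = carrier G"
      using count one_in by (intro range_from_nat_into) auto
    have "?\<mu> A = 0" if "A \<in> set As" for A
    proof -
      have "A \<subseteq> (\<Union>g\<in>range (from_nat_into (carrier G)). \<phi> g ` \<Union>(set Bs))"
        using sat that unfolding range saturation_def by blast
      then have "?\<mu> A \<le> ?\<mu> (\<Union>n. \<phi> (from_nat_into (carrier G) n) ` \<Union>(set Bs))"
        by (intro outer_mono) simp
      also have "\<dots> \<le> suminf (\<lambda>n. ?\<mu> (\<phi> (from_nat_into (carrier G) n) ` \<Union>(set Bs)))" by (rule outer_UN)
      also have "\<dots> = 0"
      proof -
        have "?\<mu> (\<phi> g ` \<Union>(set Bs)) = 0" if g: "g \<in> carrier G" for g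
        proof -
          have "?\<mu> (\<phi> g ` \<Union>(set Bs)) = ?\<mu> (\<Union>(set Bs))"
            by (rule outer_homeomorphism[of "\<phi> (inv\<^bsub>G\<^esub> g)"])
              (use g in \<open>auto simp: act_inv D_inv intro!: act_continuous inv_in\<close>)
          then show ?thesis using B0 by simp
        qed
        moreover have "from_nat_into (carrier G) n \<in> carrier G" for n using range by blast
        ultimately show ?thesis by simp
      qed
      finally show ?thesis by simp
    qed
    then have "(\<Sum>A\<leftarrow>As. ?\<mu> A) = 0" by (simp add: sum_list_eq_0_iff)
    then show False using \<mu>A by (metis not_one_le_zero)
  next
    case False
    define c where "c = 1 / s"
    have "s < Orderings.top" using s1 ennreal_one_less_top by (rule order.strict_trans1)
    then have cs: "c * s = 1"
      unfolding c_def ennreal_divide_times using False by (simp add: ennreal_divide_self)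
    interpret scaled: open_content "\<lambda>A. c * D A" by (rule scaled_content)
    have \<mu>': "scaled.outer_content \<in> invariant_premeasures G \<phi>"
      by (rule scaled.outer_invariant_premeasure) (use inv_fun act_continuous D_inv in auto)
    have sum': "(\<Sum>C\<leftarrow>Cs. scaled.outer_content C) = c * (\<Sum>C\<leftarrow>Cs. ?\<mu> C)" if "\<forall>C\<in>set Cs. open C" for Cs
      using that outer_scaled_open[of _ c] by (simp add: sum_list_const_mult cong: map_cong)
    have "c * (\<Sum>A\<leftarrow>As. ?\<mu> A) < 1"
      using less[OF \<mu>'] cs by (simp add: sum' opA opB s_def)
    moreover have "1 \<le> c" using cs s1 mult_left_mono[OF s1, of c] by simp
    then have "1 * 1 \<le> c * (\<Sum>A\<leftarrow>As. ?\<mu> A)" using \<mu>A by (intro mult_mono) auto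
    ultimately show False by simp
  qed
qed

section \<open>The generalized type semigroup through lists of open sets\<close>

lemma open_eq_support:
  fixes A :: "'x::metric_space set"
  assumes "open A"
  obtains f where "f \<in> nonneg_continuous" "support_on UNIV f = A"
proof (cases "A = UNIV")
  case True
  then show ?thesis using that[of "\<lambda>_. 1"] by (auto simp: nonneg_continuous_def support_on_def)
next
  case False
  have "support_on UNIV (\<lambda>x. infdist x (- A)) = A"
    using in_closed_iff_infdist_zero[of "- A"] assms False by (auto simp: support_on_def)
  moreover have "continuous_on UNIV (\<lambda>x. infdist x (- A))"
    by (intro continuous_on_infdist continuous_on_id)
  ultimately show ?thesis
    using that[of "\<lambda>x. infdist x (- A)"] by (auto simp: nonneg_continuous_def infdist_nonneg)
qed

lemma open_list_eq_supports:
  fixes As :: "'x::metric_space set list"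
  assumes "\<forall>A\<in>set As. open A" "As \<noteq> []"
  obtains fs where "fs \<in> K_tuples" "map (support_on UNIV) fs = As"
proof -
  have "\<exists>fs. set fs \<subseteq> nonneg_continuous \<and> map (support_on UNIV) fs = As"
    using assms(1)
  proof (induction As)
    case (Cons A As)
    then obtain fs where fs: "set fs \<subseteq> nonneg_continuous" "map (support_on UNIV) fs = As" by auto
    obtain f where "f \<in> nonneg_continuous" "support_on UNIV f = A" using open_eq_support Cons.prems by auto
    then show ?case using fs by (intro exI[of _ "f # fs"]) auto
  qed simp
  then show ?thesis using that assms(2) by (force simp: K_tuples_def)
qed

lemma open_support: "f \<in> nonneg_continuous \<Longrightarrow> open (support_on UNIV f)"
  unfolding nonneg_continuous_def support_on_def
  by (auto intro!: open_Collect_neq continuous_intros)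

lemma open_supports: "fs \<in> K_tuples \<Longrightarrow> \<forall>A\<in>set (map (support_on UNIV) fs). open A"
  using open_support by (auto simp: K_tuples_def)

context compact_action
begin

lemma K_le_refl: "a \<in> K_tuples \<Longrightarrow> K_le G \<phi> a a"
  unfolding K_le_def by (intro dyn_subequiv_refl open_supports)

lemma K_le_trans: "K_le G \<phi> a b \<Longrightarrow> K_le G \<phi> b c \<Longrightarrow> K_le G \<phi> a c"
  unfolding K_le_def by (rule dyn_subequiv_trans)

lemma K_le_append: "K_le G \<phi> a b \<Longrightarrow> K_le G \<phi> a' b' \<Longrightarrow> K_le G \<phi> (a @ a') (b @ b')"
  unfolding K_le_def by (simp add: dyn_subequiv_append)

lemma equiv_K_equiv: "equiv K_tuples (K_equiv G \<phi>)"
proof (rule equivI)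
  show "K_equiv G \<phi> \<subseteq> K_tuples \<times> K_tuples" by (auto simp: K_equiv_def)
  show "refl_on K_tuples (K_equiv G \<phi>)" by (auto simp: refl_on_def K_equiv_def K_le_refl)
  show "sym (K_equiv G \<phi>)" by (auto simp: sym_def K_equiv_def)
  show "trans (K_equiv G \<phi>)" by (auto simp: trans_def K_equiv_def intro: K_le_trans)
qed

lemma K_class_iff: "b \<in> K_equiv G \<phi> `` {a} \<longleftrightarrow> a \<in> K_tuples \<and> b \<in> K_tuples \<and> K_le G \<phi> a b \<and> K_le G \<phi> b a"
  by (auto simp: K_equiv_def)

lemma W_le_class:
  assumes "a \<in> K_tuples" "b \<in> K_tuples"
  shows "W_le G \<phi> (K_equiv G \<phi> `` {a}) (K_equiv G \<phi> `` {b}) \<longleftrightarrow> K_le G \<phi> a b"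
  unfolding W_le_def Bex_def K_class_iff using assms K_le_trans K_le_refl by meson

lemma W_add_class:
  assumes "a \<in> K_tuples" "b \<in> K_tuples"
  shows "W_add G \<phi> (K_equiv G \<phi> `` {a}) (K_equiv G \<phi> `` {b}) = K_equiv G \<phi> `` {a @ b}"
proof -
  have "K_equiv G \<phi> `` {a' @ b'} = K_equiv G \<phi> `` {a @ b}"
    if "a' \<in> K_equiv G \<phi> `` {a}" "b' \<in> K_equiv G \<phi> `` {b}" for a' b'
  proof (rule equiv_class_eq[OF equiv_K_equiv])
    show "(a' @ b', a @ b) \<in> K_equiv G \<phi>"
      using that unfolding K_class_iff K_equiv_def by (auto simp: K_tuples_def intro: K_le_append)
  qed
  moreover have "a \<in> K_equiv G \<phi> `` {a}" "b \<in> K_equiv G \<phi> `` {b}"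
    unfolding K_class_iff using assms K_le_refl by auto
  ultimately show ?thesis unfolding W_add_def by blast
qed

lemma W_multiple_class:
  assumes a: "a \<in> K_tuples" and n: "n > 0"
  shows "sg_multiple (W_add G \<phi>) n (K_equiv G \<phi> `` {a}) = K_equiv G \<phi> `` {concat (replicate n a)}"
proof -
  have "(W_add G \<phi> (K_equiv G \<phi> `` {a}) ^^ m) (K_equiv G \<phi> `` {a}) = K_equiv G \<phi> `` {concat (replicate (Suc m) a)}" for m
  proof (induction m)
    case (Suc m)
    have "concat (replicate (Suc m) a) \<in> K_tuples" using a by (auto simp: K_tuples_def)
    then show ?case using Suc W_add_class[OF a] by simp
  qed simp
  from this[of "n - 1"] show ?thesis using n by (simp add: sg_multiple_def)
qed

text \<open>
  Classes of tuples of functions carry the same information as lists of open sets, since the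
  order only sees supports and every open set is a support.
\<close>

lemma almost_unperforated_iff:
  "almost_unperforated (W_carrier G \<phi>) (W_add G \<phi>) (W_le G \<phi>) \<longleftrightarrow>
     (\<forall>As Bs. As \<noteq> [] \<longrightarrow> Bs \<noteq> [] \<longrightarrow> (\<forall>A\<in>set As. open A) \<longrightarrow> (\<forall>B\<in>set Bs. open B) \<longrightarrow>
       (\<exists>n>0. dyn_subequiv G \<phi> (concat (replicate (Suc n) As)) (concat (replicate n Bs))) \<longrightarrow>
       dyn_subequiv G \<phi> As Bs)" (is "?L \<longleftrightarrow> ?R")
proof -
  let ?s = "map (support_on UNIV) :: ('x \<Rightarrow> real) list \<Rightarrow> _"
  have "?L \<longleftrightarrow> (\<forall>a\<in>K_tuples. \<forall>b\<in>K_tuples.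
      (\<exists>n>0. K_le G \<phi> (concat (replicate (n + 1) a)) (concat (replicate n b))) \<longrightarrow> K_le G \<phi> a b)"
  proof -
    have rep: "concat (replicate n a) \<in> K_tuples" if "a \<in> K_tuples" "n > 0" for a :: "('x \<Rightarrow> real) list" and n
      using that by (cases n) (auto simp: K_tuples_def)
    have "W_le G \<phi> (sg_multiple (W_add G \<phi>) (n + 1) (K_equiv G \<phi> `` {a})) (sg_multiple (W_add G \<phi>) n (K_equiv G \<phi> `` {b}))
       \<longleftrightarrow> K_le G \<phi> (concat (replicate (n + 1) a)) (concat (replicate n b))"
      if "a \<in> K_tuples" "b \<in> K_tuples" "n > 0" for a b n
      using that W_multiple_class W_le_class[OF rep rep] by (metis add_gr_0 zero_less_one)
    then show ?thesis
      unfolding almost_unperforated_def W_carrier_def quotient_def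
      using W_le_class by (simp add: Ball_def) blast
  qed
  also have "\<dots> \<longleftrightarrow> (\<forall>a\<in>K_tuples. \<forall>b\<in>K_tuples.
      (\<exists>n>0. dyn_subequiv G \<phi> (concat (replicate (Suc n) (?s a))) (concat (replicate n (?s b)))) \<longrightarrow>
        dyn_subequiv G \<phi> (?s a) (?s b))"
    by (simp add: K_le_def map_concat map_replicate)
  also have "\<dots> \<longleftrightarrow> ?R"
  proof
    assume H: "\<forall>a\<in>K_tuples. \<forall>b\<in>K_tuples.
      (\<exists>n>0. dyn_subequiv G \<phi> (concat (replicate (Suc n) (?s a))) (concat (replicate n (?s b)))) \<longrightarrow>
        dyn_subequiv G \<phi> (?s a) (?s b)"
    show ?R
    proof (intro allI impI)
      fix As Bs :: "'x set list"
      assume AB: "As \<noteq> []" "Bs \<noteq> []" "\<forall>A\<in>set As. open A" "\<forall>B\<in>set Bs. open B" and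
        mult: "\<exists>n>0. dyn_subequiv G \<phi> (concat (replicate (Suc n) As)) (concat (replicate n Bs))"
      obtain a b where ab: "a \<in> K_tuples" "?s a = As" "b \<in> K_tuples" "?s b = Bs"
        using open_list_eq_supports AB by metis
      show "dyn_subequiv G \<phi> As Bs" using H[rule_format, OF ab(1,3)] mult unfolding ab by blast
    qed
  next
    assume R: ?R
    show "\<forall>a\<in>K_tuples. \<forall>b\<in>K_tuples.
      (\<exists>n>0. dyn_subequiv G \<phi> (concat (replicate (Suc n) (?s a))) (concat (replicate n (?s b)))) \<longrightarrow>
        dyn_subequiv G \<phi> (?s a) (?s b)"
    proof (intro ballI impI)
      fix a b :: "('x \<Rightarrow> real) list"
      assume "a \<in> K_tuples" "b \<in> K_tuples" and
        "\<exists>n>0. dyn_subequiv G \<phi> (concat (replicate (Suc n) (?s a))) (concat (replicate n (?s b)))"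
      moreover from this have "?s a \<noteq> []" "?s b \<noteq> []" by (auto simp: K_tuples_def)
      ultimately show "dyn_subequiv G \<phi> (?s a) (?s b)" using R open_supports by blast
    qed
  qed
  finally show ?thesis .
qed

end

section \<open>Almost unperforation and strict comparison\<close>

theorem theoremA:
  fixes G :: "('g, 'm) monoid_scheme"
    and \<phi> :: "'g \<Rightarrow> 'x::metric_space \<Rightarrow> 'x"
  assumes "countable (carrier G)" and "infinite (carrier G)"
    and "compact (UNIV :: 'x set)" and "infinite (UNIV :: 'x set)"
    and "continuous_action G \<phi>"
  shows "almost_unperforated (W_carrier G \<phi>) (W_add G \<phi>) (W_le G \<phi>) \<longleftrightarrow>
    (\<forall>As Bs :: 'x set list.
       As \<noteq> [] \<and> Bs \<noteq> [] \<and> (\<forall>A\<in>set As. open A) \<and> (\<forall>B\<in>set Bs. open B) \<and>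
       \<Union>(set As) \<subseteq> saturation G \<phi> (\<Union>(set Bs)) \<and>
       (\<forall>\<mu>\<in>invariant_premeasures G \<phi>.
          (\<Sum>B\<leftarrow>Bs. \<mu> B) = 1 \<longrightarrow> (\<Sum>A\<leftarrow>As. \<mu> A) < (\<Sum>B\<leftarrow>Bs. \<mu> B))
       \<longrightarrow> dyn_subequiv G \<phi> As Bs)"
proof -
  interpret compact_action G \<phi> using assms by unfold_locales
  show ?thesis
    unfolding almost_unperforated_iff
  proof (intro iffI allI impI)
    fix As Bs :: "'x set list"
    assume au: "\<forall>As Bs. As \<noteq> [] \<longrightarrow> Bs \<noteq> [] \<longrightarrow> (\<forall>A\<in>set As. open A) \<longrightarrow> (\<forall>B\<in>set Bs. open B) \<longrightarrow>
       (\<exists>n>0. dyn_subequiv G \<phi> (concat (replicate (Suc n) As)) (concat (replicate n Bs))) \<longrightarrow>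
       dyn_subequiv G \<phi> As Bs"
    assume "As \<noteq> [] \<and> Bs \<noteq> [] \<and> (\<forall>A\<in>set As. open A) \<and> (\<forall>B\<in>set Bs. open B) \<and>
       \<Union>(set As) \<subseteq> saturation G \<phi> (\<Union>(set Bs)) \<and>
       (\<forall>\<mu>\<in>invariant_premeasures G \<phi>.
          (\<Sum>B\<leftarrow>Bs. \<mu> B) = 1 \<longrightarrow> (\<Sum>A\<leftarrow>As. \<mu> A) < (\<Sum>B\<leftarrow>Bs. \<mu> B))"
    then have AB: "As \<noteq> []" "Bs \<noteq> []" "\<forall>A\<in>set As. open A" "\<forall>B\<in>set Bs. open B"
      and sat: "\<Union>(set As) \<subseteq> saturation G \<phi> (\<Union>(set Bs))"
      and less: "\<And>\<mu>. \<mu> \<in> invariant_premeasures G \<phi> \<Longrightarrow> (\<Sum>B\<leftarrow>Bs. \<mu> B) = 1 \<Longrightarrow>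
          (\<Sum>A\<leftarrow>As. \<mu> A) < (\<Sum>B\<leftarrow>Bs. \<mu> B)" by auto
    show "dyn_subequiv G \<phi> As Bs"
    proof (rule dyn_subequiv_approx[OF AB(3)])
      fix As' assume As': "length As' = length As"
        "\<And>i. i < length As \<Longrightarrow> open (As' ! i) \<and> closure (As' ! i) \<subseteq> As ! i"
      have "\<exists>n>0. dyn_subequiv G \<phi> (concat (replicate (Suc n) As')) (concat (replicate n Bs))"
        by (rule strict_comparison_multiples[OF assms(1) AB(3,4) sat _ As']) (rule less)
      moreover have "As' \<noteq> []" using As' AB(1) by auto
      moreover have "\<forall>A\<in>set As'. open A" using As' by (metis in_set_conv_nth)
      ultimately show "dyn_subequiv G \<phi> As' Bs" using au AB(2,4) by blast
    qed
  next
    fix As Bs :: "'x set list"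
    assume ii: "\<forall>As Bs :: 'x set list.
       As \<noteq> [] \<and> Bs \<noteq> [] \<and> (\<forall>A\<in>set As. open A) \<and> (\<forall>B\<in>set Bs. open B) \<and>
       \<Union>(set As) \<subseteq> saturation G \<phi> (\<Union>(set Bs)) \<and>
       (\<forall>\<mu>\<in>invariant_premeasures G \<phi>.
          (\<Sum>B\<leftarrow>Bs. \<mu> B) = 1 \<longrightarrow> (\<Sum>A\<leftarrow>As. \<mu> A) < (\<Sum>B\<leftarrow>Bs. \<mu> B))
       \<longrightarrow> dyn_subequiv G \<phi> As Bs"
      and AB: "As \<noteq> []" "Bs \<noteq> []" "\<forall>A\<in>set As. open A" "\<forall>B\<in>set Bs. open B"
      and "\<exists>n>0. dyn_subequiv G \<phi> (concat (replicate (Suc n) As)) (concat (replicate n Bs))"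
    then obtain n where n: "n > 0"
      "dyn_subequiv G \<phi> (concat (replicate (Suc n) As)) (concat (replicate n Bs))" by blast
    have "\<Union>(set As) \<subseteq> saturation G \<phi> (\<Union>(set Bs))"
      using dyn_subequiv_saturation[OF n(2)] n(1) by (simp add: set_concat)
    moreover have "(\<Sum>A\<leftarrow>As. \<mu> A) < (\<Sum>B\<leftarrow>Bs. \<mu> B)"
      if "\<mu> \<in> invariant_premeasures G \<phi>" "(\<Sum>B\<leftarrow>Bs. \<mu> B) = 1" for \<mu>
      using premeasure_less_of_multiples[OF that(1) AB(3,4) n(2) that(2)] that(2) by simp
    ultimately show "dyn_subequiv G \<phi> As Bs"
      by (intro ii[rule_format] conjI ballI impI AB) simp_all
  qed
qed

end
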